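(* Let $X$ and $Y$ be quandles, with $Y$ finite, and let $G$ be an abelian group. Suppose there exists a surjective quandle homomorphism $\pi:X\to Y$ that is locally-homogeneous, and that there are a link $L$ and a quandle $2$-cocycle $\phi\in Z^2_{\rm Q}(Y,G)$ such that the state-sum invariant $\Phi_\phi(L)\in\mathbf{Z}[G]$ is non-trivial, i.e. is not an integer (does not lie in $\mathbf{Z}\cdot 1\subset\mathbf{Z}[G]$). Then $H^2_{\rm Q}(X,G)\ne0$.
   Context: A quandle is a set $X$ with a binary operation $*$ such that (I) $a*a=a$; (II) for all $a,b$ there is a unique $c$ with $a=c*b$; (III) $(a*b)*c=(a*c)*(b*c)$. Homomorphisms are maps preserving $*$. The maps $S(b):a\mapsto a*b$ are automorphisms, and generate the group of inner automorphisms. A quandle is homogeneous if its inner automorphism group has exactly one orbit. For a homomorphism $\pi:X\to Y$ and $a\in X$, the equalizer of $a$ is the subquandle $E_a=\pi^{-1}(\pi(a))$ of $X$. $\pi$ is locally-homogeneous if every $E_a$ ($a\in X$), as a quandle in its own right, is homogeneous. Cohomology: for $n\ge1$, $C_n^{\rm R}(X)$ is free abelian on $X^n$, $C_n^{\rm R}(X)=0$ for $n\le0$, $\partial_n(x_1,\dots,x_n)=\sum_{i=2}^n(-1)^i[(x_1,\dots,x_{i-1},x_{i+1},\dots,x_n)-(x_1*x_i,\dots,x_{i-1}*x_i,x_{i+1},\dots,x_n)]$ for $n\ge2$ and $\partial_n=0$ for $n\le1$; $C_n^{\rm D}(X)$ is the subcomplex generated by tuples with $x_i=x_{i+1}$ for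 some $i$; $C_*^{\rm Q}=C_*^{\rm R}/C_*^{\rm D}$. $Z^n_{\rm Q}(X,G)$ and $H^n_{\rm Q}(X,G)$ are the cocycles and cohomology of $\mathrm{Hom}(C_*^{\rm Q}(X),G)$. Writing $G$ multiplicatively, a $2$-cocycle is a map $\phi:X\times X\to G$ with $\phi(x,x)=1$ and $\phi(x,y)\phi(x*y,z)=\phi(x,z)\phi(x*z,y*z)$. State-sum: take an oriented diagram of the link $L$ (in the oriented plane), broken at under-crossings into arcs. The normal to an arc is its tangent rotated counterclockwise by $90^\circ$. A coloring ${\cal C}$ by a finite quandle $Y$ assigns an element of $Y$ to each arc so that at each crossing, if the over-arc has color $y$ and the under-arc away from which the normal to the over-arc points has color $x$, then the other under-arc (toward which the normal points) has color $x*y$. The weight of the crossing $\tau$ is $B(\tau,{\cal C})=\phi(x,y)^{\epsilon(\tau)}$, where $\epsilon(\tau)=\pm1$ is the sign of the crossing. Then $\Phi_\phi(L)=\sum_{\cal C}\prod_\tau B(\tau,{\cal C})\in\mathbf{Z}[G]$, sum over all colorings, product over all crossings; it does not depend on the diagram of $L$. *)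

theory Defs
  imports "HOL-Analysis.Analysis" "HOL-Algebra.Bij" "HOL-Algebra.Group_Action"
    "HOL-Algebra.Generated_Groups" "HOL-Algebra.Free_Abelian_Groups"
begin

section \<open>Quandles\<close>

record 'a quandle = "'a partial_object" +
  qop :: "'a \<Rightarrow> 'a \<Rightarrow> 'a" (infixl "\<triangleright>\<index>" 70)

locale quandle =
  fixes X :: "('a, 'm) quandle_scheme" (structure)
  assumes q_closed: "\<And>a b. \<lbrakk>a \<in> carrier X; b \<in> carrier X\<rbrakk> \<Longrightarrow> a \<triangleright> b \<in> carrier X"
    and q_idem: "\<And>a. a \<in> carrier X \<Longrightarrow> a \<triangleright> a = a"
    and q_unique: "\<And>a b. \<lbrakk>a \<in> carrier X; b \<in> carrier X\<rbrakk> \<Longrightarrow> \<exists>!c. c \<in> carrier X \<and> a = c \<triangleright> b"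
    and q_distrib: "\<And>a b c. \<lbrakk>a \<in> carrier X; b \<in> carrier X; c \<in> carrier X\<rbrakk> \<Longrightarrow>
      (a \<triangleright> b) \<triangleright> c = (a \<triangleright> c) \<triangleright> (b \<triangleright> c)"

definition quandle_hom :: "('a, 'm) quandle_scheme \<Rightarrow> ('b, 'k) quandle_scheme \<Rightarrow> ('a \<Rightarrow> 'b) set" where
  "quandle_hom X Y = {f \<in> carrier X \<rightarrow> carrier Y.
     \<forall>a\<in>carrier X. \<forall>b\<in>carrier X. f (a \<triangleright>\<^bsub>X\<^esub> b) = f a \<triangleright>\<^bsub>Y\<^esub> f b}"

definition right_mult :: "('a, 'm) quandle_scheme \<Rightarrow> 'a \<Rightarrow> 'a \<Rightarrow> 'a" where
  "right_mult X b = (\<lambda>a\<in>carrier X. a \<triangleright>\<^bsub>X\<^esub> b)"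

text \<open>The maps \<open>right_mult X b\<close> are automorphisms, so the subgroup they generate in the
  automorphism group is the subgroup they generate among all permutations of the carrier.\<close>

definition inner_aut_group :: "('a, 'm) quandle_scheme \<Rightarrow> ('a \<Rightarrow> 'a) monoid" where
  "inner_aut_group X = BijGroup (carrier X)
     \<lparr>carrier := generate (BijGroup (carrier X)) (right_mult X ` carrier X)\<rparr>"

definition homogeneous :: "('a, 'm) quandle_scheme \<Rightarrow> bool" where
  "homogeneous X \<longleftrightarrow> (\<exists>!A. A \<in> orbits (inner_aut_group X) (carrier X) (\<lambda>f. f))"

definition equalizer :: "('a, 'm) quandle_scheme \<Rightarrow> ('a \<Rightarrow> 'b) \<Rightarrow> 'a \<Rightarrow> ('a, 'm) quandle_scheme" where
  "equalizer X f a = X\<lparr>carrier := {x \<in> carrier X. f x = f a}\<rparr>"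

definition locally_homogeneous :: "('a, 'm) quandle_scheme \<Rightarrow> ('a \<Rightarrow> 'b) \<Rightarrow> bool" where
  "locally_homogeneous X f \<longleftrightarrow> (\<forall>a\<in>carrier X. homogeneous (equalizer X f a))"


section \<open>Quandle cohomology\<close>

text \<open>An \<open>n\<close>-tuple is a list of length \<open>n\<close>. The degree is an integer, and all groups vanish
  in degrees \<open>n \<le> 0\<close>; in particular the empty tuple is not a \<open>0\<close>-cell.\<close>

definition rack_cells :: "('a, 'm) quandle_scheme \<Rightarrow> int \<Rightarrow> 'a list set" where
  "rack_cells X n = {xs. n \<ge> 1 \<and> int (length xs) = n \<and> set xs \<subseteq> carrier X}"

definition rack_chain_group :: "('a, 'm) quandle_scheme \<Rightarrow> int \<Rightarrow> ('a list \<Rightarrow>\<^sub>0 int) monoid" where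
  "rack_chain_group X n = free_Abelian_group (rack_cells X n)"

text \<open>List positions start at \<open>0\<close>, so the entry \<open>x\<^sub>i\<close> is \<open>xs ! (i - 1)\<close>.\<close>

definition rack_boundary_cell :: "('a, 'm) quandle_scheme \<Rightarrow> 'a list \<Rightarrow> ('a list \<Rightarrow>\<^sub>0 int)" where
  "rack_boundary_cell X xs = (\<Sum>i = 2..length xs. frag_cmul ((- 1) ^ i)
     (frag_of (take (i - 1) xs @ drop i xs)
      - frag_of (map (\<lambda>y. y \<triangleright>\<^bsub>X\<^esub> xs ! (i - 1)) (take (i - 1) xs) @ drop i xs)))"

definition rack_boundary :: "('a, 'm) quandle_scheme \<Rightarrow> ('a list \<Rightarrow>\<^sub>0 int) \<Rightarrow> ('a list \<Rightarrow>\<^sub>0 int)" where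
  "rack_boundary X = frag_extend (rack_boundary_cell X)"

definition degenerate_chains :: "('a, 'm) quandle_scheme \<Rightarrow> int \<Rightarrow> ('a list \<Rightarrow>\<^sub>0 int) set" where
  "degenerate_chains X n = generate (rack_chain_group X n)
     (frag_of ` {xs \<in> rack_cells X n. \<exists>i. Suc i < length xs \<and> xs ! i = xs ! Suc i})"

definition quandle_chain_group :: "('a, 'm) quandle_scheme \<Rightarrow> int \<Rightarrow> ('a list \<Rightarrow>\<^sub>0 int) set monoid" where
  "quandle_chain_group X n = rack_chain_group X n Mod degenerate_chains X n"

definition chain_class :: "('a, 'm) quandle_scheme \<Rightarrow> int \<Rightarrow> ('a list \<Rightarrow>\<^sub>0 int) \<Rightarrow> ('a list \<Rightarrow>\<^sub>0 int) set" where
  "chain_class X n z = degenerate_chains X n #>\<^bsub>rack_chain_group X n\<^esub> z"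

text \<open>The boundary from degree \<open>n\<close> to degree \<open>n - 1\<close>; all representatives \<open>z\<close> of a class
  have boundaries in the same class because degenerate chains form a subcomplex.\<close>

definition quandle_boundary ::
  "('a, 'm) quandle_scheme \<Rightarrow> int \<Rightarrow> ('a list \<Rightarrow>\<^sub>0 int) set \<Rightarrow> ('a list \<Rightarrow>\<^sub>0 int) set" where
  "quandle_boundary X n c = the_elem ((\<lambda>z. chain_class X (n - 1) (rack_boundary X z)) ` c)"

definition hom_group :: "('a, 'm) monoid_scheme \<Rightarrow> ('b, 'k) monoid_scheme \<Rightarrow> ('a \<Rightarrow> 'b) monoid" where
  "hom_group A G = \<lparr>carrier = hom A G \<inter> extensional (carrier A),
     mult = (\<lambda>f g. \<lambda>x\<in>carrier A. f x \<otimes>\<^bsub>G\<^esub> g x),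
     one = (\<lambda>x\<in>carrier A. \<one>\<^bsub>G\<^esub>)\<rparr>"

definition quandle_cochain_group ::
  "('a, 'm) quandle_scheme \<Rightarrow> ('g, 'k) monoid_scheme \<Rightarrow> int \<Rightarrow> (('a list \<Rightarrow>\<^sub>0 int) set \<Rightarrow> 'g) monoid" where
  "quandle_cochain_group X G n = hom_group (quandle_chain_group X n) G"

text \<open>The coboundary from degree \<open>n\<close> to degree \<open>n + 1\<close>.\<close>

definition quandle_coboundary ::
  "('a, 'm) quandle_scheme \<Rightarrow> int \<Rightarrow> (('a list \<Rightarrow>\<^sub>0 int) set \<Rightarrow> 'g) \<Rightarrow> (('a list \<Rightarrow>\<^sub>0 int) set \<Rightarrow> 'g)" where
  "quandle_coboundary X n f =
     (\<lambda>c\<in>carrier (quandle_chain_group X (n + 1)). f (quandle_boundary X (n + 1) c))"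

definition quandle_cocycles ::
  "('a, 'm) quandle_scheme \<Rightarrow> ('g, 'k) monoid_scheme \<Rightarrow> int \<Rightarrow> (('a list \<Rightarrow>\<^sub>0 int) set \<Rightarrow> 'g) set" where
  "quandle_cocycles X G n =
     kernel (quandle_cochain_group X G n) (quandle_cochain_group X G (n + 1)) (quandle_coboundary X n)"

definition quandle_coboundaries ::
  "('a, 'm) quandle_scheme \<Rightarrow> ('g, 'k) monoid_scheme \<Rightarrow> int \<Rightarrow> (('a list \<Rightarrow>\<^sub>0 int) set \<Rightarrow> 'g) set" where
  "quandle_coboundaries X G n =
     quandle_coboundary X (n - 1) ` carrier (quandle_cochain_group X G (n - 1))"

definition quandle_cohomology_group ::
  "('a, 'm) quandle_scheme \<Rightarrow> ('g, 'k) monoid_scheme \<Rightarrow> int \<Rightarrow>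
     (('a list \<Rightarrow>\<^sub>0 int) set \<Rightarrow> 'g) set monoid" where
  "quandle_cohomology_group X G n =
     quandle_cochain_group X G n \<lparr>carrier := quandle_cocycles X G n\<rparr> Mod quandle_coboundaries X G n"

text \<open>A \<open>2\<close>-cochain viewed as a function of two quandle elements.\<close>

definition cochain2_value ::
  "('a, 'm) quandle_scheme \<Rightarrow> (('a list \<Rightarrow>\<^sub>0 int) set \<Rightarrow> 'g) \<Rightarrow> 'a \<Rightarrow> 'a \<Rightarrow> 'g" where
  "cochain2_value X \<phi> x y = \<phi> (chain_class X 2 (frag_of [x, y]))"


section \<open>Links and their diagrams\<close>

text \<open>An oriented link is a nonempty list of regular closed curves in 3-space, parametrized with
  period \<open>1\<close>, that are embedded and pairwise disjoint. Continuously differentiable regularity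
  excludes wild links; up to ambient isotopy it gives the same links as smooth or polygonal
  curves.\<close>

type_synonym curves = "(real \<Rightarrow> real ^ 3) list"

definition params :: "curves \<Rightarrow> (nat \<times> real) set" where
  "params L = {..<length L} \<times> {0..<1}"

definition pt :: "curves \<Rightarrow> nat \<times> real \<Rightarrow> real ^ 3" where
  "pt L = (\<lambda>(i, t). (L ! i) t)"

definition velocity :: "curves \<Rightarrow> nat \<times> real \<Rightarrow> real ^ 3" where
  "velocity L = (\<lambda>(i, t). vector_derivative (L ! i) (at t))"

definition oriented_link :: "curves \<Rightarrow> bool" where
  "oriented_link L \<longleftrightarrow> L \<noteq> [] \<and>
     (\<forall>\<gamma>\<in>set L. (\<forall>t. \<gamma> (t + 1) = \<gamma> t) \<and> \<gamma> C1_differentiable_on UNIV) \<and>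
     (\<forall>a\<in>params L. velocity L a \<noteq> 0) \<and> inj_on (pt L) (params L)"

text \<open>Equivalence of oriented links: an ambient isotopy carries one to the other, up to the order
  of the components and orientation preserving reparametrization.\<close>

definition link_equivalent :: "curves \<Rightarrow> curves \<Rightarrow> bool" where
  "link_equivalent L D \<longleftrightarrow>
     (\<exists>h p. homotopic_with (homeomorphic_map euclidean euclidean) euclidean euclidean id h \<and>
        bij_betw p {..<length L} {..<length D} \<and>
        (\<forall>i<length L. \<exists>u :: real \<Rightarrow> real. strict_mono u \<and> continuous_on UNIV u \<and>
           (\<forall>t. u (t + 1) = u t + 1) \<and> (\<forall>t. h ((L ! i) t) = (D ! p i) (u t))))"

text \<open>Diagrams are drawn in the complex plane, the last coordinate being the height. Rotation
  counterclockwise by a right angle is multiplication by the imaginary unit, and \<open>inner\<close> is the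
  Euclidean inner product of the plane.\<close>

definition proj :: "real ^ 3 \<Rightarrow> complex" where
  "proj v = Complex (v $ 1) (v $ 2)"

definition tangent :: "curves \<Rightarrow> nat \<times> real \<Rightarrow> complex" where
  "tangent D a = proj (velocity D a)"

definition normal_vec :: "curves \<Rightarrow> nat \<times> real \<Rightarrow> complex" where
  "normal_vec D a = \<i> * tangent D a"

text \<open>A crossing is the pair (over-parameter, under-parameter).\<close>

type_synonym crossing = "(nat \<times> real) \<times> (nat \<times> real)"

definition crossings :: "curves \<Rightarrow> crossing set" where
  "crossings D = {(a, b). a \<in> params D \<and> b \<in> params D \<and>
     proj (pt D a) = proj (pt D b) \<and> pt D a $ 3 > pt D b $ 3}"

text \<open>A diagram is a link in general position with respect to the projection: the projection is
  an immersion whose only multiple points are finitely many transverse double points.\<close>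

definition link_diagram :: "curves \<Rightarrow> bool" where
  "link_diagram D \<longleftrightarrow> oriented_link D \<and>
     (\<forall>a\<in>params D. tangent D a \<noteq> 0) \<and>
     finite (crossings D) \<and>
     (\<forall>a\<in>params D. \<forall>b\<in>params D. \<forall>c\<in>params D.
        proj (pt D a) = proj (pt D b) \<and> proj (pt D b) = proj (pt D c) \<longrightarrow> a = b \<or> b = c \<or> a = c) \<and>
     (\<forall>(a, b)\<in>crossings D. inner (normal_vec D a) (tangent D b) \<noteq> 0)"

definition diagram_of :: "curves \<Rightarrow> curves \<Rightarrow> bool" where
  "diagram_of D L \<longleftrightarrow> link_diagram D \<and> link_equivalent L D"

text \<open>The arcs are kept as subsets of 3-space, so that two strands of the plane picture
  meeting at a crossing remain disjoint.\<close>

definition broken_curves :: "curves \<Rightarrow> (real ^ 3) set" where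
  "broken_curves D = pt D ` params D - pt D ` snd ` crossings D"

definition arcs :: "curves \<Rightarrow> (real ^ 3) set set" where
  "arcs D = components (broken_curves D)"

definition over_arc :: "curves \<Rightarrow> crossing \<Rightarrow> (real ^ 3) set" where
  "over_arc D = (\<lambda>(a, b). THE A. A \<in> arcs D \<and> pt D a \<in> A)"

text \<open>The under-arcs just before and just after the crossing, in the direction of the orientation.\<close>

definition under_arc_in :: "curves \<Rightarrow> crossing \<Rightarrow> (real ^ 3) set" where
  "under_arc_in D = (\<lambda>(a, (j, t)). THE A. A \<in> arcs D \<and> (\<forall>\<^sub>F r in at_left t. pt D (j, r) \<in> A))"

definition under_arc_out :: "curves \<Rightarrow> crossing \<Rightarrow> (real ^ 3) set" where
  "under_arc_out D = (\<lambda>(a, (j, t)). THE A. A \<in> arcs D \<and> (\<forall>\<^sub>F r in at_right t. pt D (j, r) \<in> A))"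

text \<open>If the normal of the over-arc has positive inner product with the tangent of the
  under-strand, the latter runs from the side the normal points away from to the side the normal
  points to.\<close>

definition normal_along :: "curves \<Rightarrow> crossing \<Rightarrow> bool" where
  "normal_along D = (\<lambda>(a, b). inner (normal_vec D a) (tangent D b) > 0)"

definition under_arc_source :: "curves \<Rightarrow> crossing \<Rightarrow> (real ^ 3) set" where
  "under_arc_source D \<tau> = (if normal_along D \<tau> then under_arc_in D \<tau> else under_arc_out D \<tau>)"

definition under_arc_target :: "curves \<Rightarrow> crossing \<Rightarrow> (real ^ 3) set" where
  "under_arc_target D \<tau> = (if normal_along D \<tau> then under_arc_out D \<tau> else under_arc_in D \<tau>)"

text \<open>The right-handed sign: \<open>1\<close> iff (tangent of the over-strand, tangent of the under-strand) is a
  positively oriented basis of the plane. Its determinant, the imaginary part below, equals the inner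
  product in \<open>normal_along\<close>.\<close>

definition crossing_sign :: "curves \<Rightarrow> crossing \<Rightarrow> int" where
  "crossing_sign D = (\<lambda>(a, b). if Im (cnj (tangent D a) * tangent D b) > 0 then 1 else - 1)"


section \<open>The state-sum invariant\<close>

definition colorings ::
  "('a, 'm) quandle_scheme \<Rightarrow> curves \<Rightarrow> ((real ^ 3) set \<Rightarrow> 'a) set" where
  "colorings Y D = {C \<in> arcs D \<rightarrow>\<^sub>E carrier Y. \<forall>\<tau>\<in>crossings D.
     C (under_arc_target D \<tau>) = C (under_arc_source D \<tau>) \<triangleright>\<^bsub>Y\<^esub> C (over_arc D \<tau>)}"

definition crossing_weight ::
  "('a, 'm) quandle_scheme \<Rightarrow> ('g, 'k) monoid_scheme \<Rightarrow> (('a list \<Rightarrow>\<^sub>0 int) set \<Rightarrow> 'g) \<Rightarrow> curves \<Rightarrow>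
     ((real ^ 3) set \<Rightarrow> 'a) \<Rightarrow> crossing \<Rightarrow> 'g" where
  "crossing_weight Y G \<phi> D C \<tau> =
     cochain2_value Y \<phi> (C (under_arc_source D \<tau>)) (C (over_arc D \<tau>)) [^]\<^bsub>G\<^esub> crossing_sign D \<tau>"

text \<open>The integral group ring of \<open>G\<close> is additively the free abelian group on the elements of
  \<open>G\<close>, and its integers are the multiples of the basis element \<open>\<one>\<close>.\<close>

definition state_sum ::
  "('a, 'm) quandle_scheme \<Rightarrow> ('g, 'k) monoid_scheme \<Rightarrow> (('a list \<Rightarrow>\<^sub>0 int) set \<Rightarrow> 'g) \<Rightarrow> curves \<Rightarrow>
     ('g \<Rightarrow>\<^sub>0 int)" where
  "state_sum Y G \<phi> D =
     (\<Sum>C\<in>colorings Y D. frag_of (\<Otimes>\<^bsub>G\<^esub>\<tau>\<in>crossings D. crossing_weight Y G \<phi> D C \<tau>))"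

definition group_ring_ints :: "('g, 'k) monoid_scheme \<Rightarrow> ('g \<Rightarrow>\<^sub>0 int) set" where
  "group_ring_ints G = range (\<lambda>m. frag_cmul m (frag_of \<one>\<^bsub>G\<^esub>))"

end

(* If H^2(X, G) = 0, the pullback of phi along pi is a coboundary, so phi (pi x, pi y) = f x / f (x * y) for
   some f on X. On a fibre of pi the left hand side is phi (u, u) = 1, so f is invariant under the inner
   automorphisms of the fibre and hence constant on it, by local homogeneity. Thus f = g o pi, and phi is the
   coboundary of g. The weight of a crossing is then g (incoming under-arc) / g (outgoing under-arc), for both
   signs; along a component the outgoing arc of one undercrossing is the incoming arc of the next, so
   the product over all crossings telescopes to 1 and the state-sum is the number of colorings. *)

theory Submission
  imports Defs
begin

section \<open>Quandle chains and 2-cocycles\<close>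

text \<open>The cohomology is defined on classes of chains, but the descent along
  \<open>\<pi>\<close> concerns functions of one or two elements. The translation stays in degrees 1
  to 3, where every boundary can be written out: a 2-cocycle yields a function satisfying
  \<open>cocycle2_fun\<close>, and each such function is realised by a 2-cocycle through the
  universal properties of free abelian groups and quotients. The pullback is thus formed on
  functions, without an induced chain map. On the geometric side, arcs are connected components of a
  subset of space and the under-arcs at a crossing are chosen by \<open>THE\<close>. Telescoping
  therefore needs a proof that neighbouring undercrossings bound a common component. Each closed
  curve is cut open at parameter 0, so the step from its last undercrossing to its first passes the
  cut; strands are followed on the unrolled parameter line and reduced by \<open>frac\<close>. The
  successor maps of the curves combine into one permutation of all crossings, and telescoping
  becomes reindexing of a product.\<close>

lemma carrier_rack_chain_group [simp]:
  "z \<in> carrier (rack_chain_group X n) \<longleftrightarrow> Poly_Mapping.keys z \<subseteq> rack_cells X n"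
  by (simp add: rack_chain_group_def)

lemma subgroup_degenerate_chains: "subgroup (degenerate_chains X n) (rack_chain_group X n)"
  unfolding degenerate_chains_def rack_chain_group_def
  by (rule group.generate_is_subgroup) auto

lemma normal_degenerate_chains: "degenerate_chains X n \<lhd> rack_chain_group X n"
  using comm_group.normal_iff_subgroup abelian_free_Abelian_group subgroup_degenerate_chains
  unfolding rack_chain_group_def by blast

lemma degenerate_chains_zero: "0 \<in> degenerate_chains X n"
  using subgroup.one_closed[OF subgroup_degenerate_chains, of X n]
  by (simp add: rack_chain_group_def)

lemma degenerate_chains_add:
  "\<lbrakk>a \<in> degenerate_chains X n; b \<in> degenerate_chains X n\<rbrakk> \<Longrightarrow> a + b \<in> degenerate_chains X n"
  using subgroup.m_closed[OF subgroup_degenerate_chains, of a X n b]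
  by (simp add: rack_chain_group_def)

lemma degenerate_chains_keys: "a \<in> degenerate_chains X n \<Longrightarrow> Poly_Mapping.keys a \<subseteq> rack_cells X n"
  using subgroup.mem_carrier[OF subgroup_degenerate_chains, of a X n] by simp

lemma degenerate_chains_uminus: "a \<in> degenerate_chains X n \<Longrightarrow> - a \<in> degenerate_chains X n"
  using subgroup.m_inv_closed[OF subgroup_degenerate_chains, of a X n] degenerate_chains_keys[of a X n]
  by (simp add: rack_chain_group_def)

lemma degenerate_chains_diff:
  "\<lbrakk>a \<in> degenerate_chains X n; b \<in> degenerate_chains X n\<rbrakk> \<Longrightarrow> a - b \<in> degenerate_chains X n"
  using degenerate_chains_add[of a X n "- b"] degenerate_chains_uminus by fastforce

text \<open>\<open>generate\<close> speaks of the operations of the chain group; here they become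
  \<open>+\<close> and \<open>-\<close> of chains. The support hypotheses in the steps are what a
  homomorphism on the free abelian group asks for.\<close>

lemma degenerate_chains_induct [consumes 1, case_names zero cell uminus add]:
  assumes "a \<in> degenerate_chains X n"
    and "P 0"
    and cell: "\<And>xs i. \<lbrakk>xs \<in> rack_cells X n; Suc i < length xs; xs ! i = xs ! Suc i\<rbrakk> \<Longrightarrow> P (frag_of xs)"
    and um: "\<And>a. \<lbrakk>Poly_Mapping.keys a \<subseteq> rack_cells X n; P a\<rbrakk> \<Longrightarrow> P (- a)"
    and add: "\<And>a b. \<lbrakk>Poly_Mapping.keys a \<subseteq> rack_cells X n; Poly_Mapping.keys b \<subseteq> rack_cells X n;
      P a; P b\<rbrakk> \<Longrightarrow> P (a + b)"
  shows "P a"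
  using assms(1) unfolding degenerate_chains_def
proof (induction rule: generate.induct)
  case one
  then show ?case using assms(2) by (simp add: rack_chain_group_def)
next
  case (incl h)
  then show ?case using cell by blast
next
  case (inv h)
  then obtain xs i where h: "h = frag_of xs" "xs \<in> rack_cells X n" "Suc i < length xs" "xs ! i = xs ! Suc i"
    by blast
  then have "P (- h)" using um cell by simp
  moreover have "inv\<^bsub>rack_chain_group X n\<^esub> h = - h" using h by (simp add: rack_chain_group_def)
  ultimately show ?case by simp
next
  case (eng a b)
  then show ?case
    using add[of a b] degenerate_chains_keys[of a X n] degenerate_chains_keys[of b X n]
    by (simp add: degenerate_chains_def rack_chain_group_def)
qed

lemma degenerate_chainsI:
  "\<lbrakk>xs \<in> rack_cells X n; Suc i < length xs; xs ! i = xs ! Suc i\<rbrakk> \<Longrightarrow> frag_of xs \<in> degenerate_chains X n"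
  unfolding degenerate_chains_def by (rule generate.incl) blast

lemma group_quandle_chain_group: "group (quandle_chain_group X n)"
  unfolding quandle_chain_group_def by (rule normal.factorgroup_is_group[OF normal_degenerate_chains])

lemma chain_class_hom:
  "chain_class X n \<in> hom (rack_chain_group X n) (quandle_chain_group X n)"
  using normal.r_coset_hom_Mod[OF normal_degenerate_chains]
  by (simp add: chain_class_def[abs_def] quandle_chain_group_def)

lemma quandle_chain_group_carrierE:
  assumes "c \<in> carrier (quandle_chain_group X n)"
  obtains z where "Poly_Mapping.keys z \<subseteq> rack_cells X n" "c = chain_class X n z"
  using assms unfolding quandle_chain_group_def FactGroup_def RCOSETS_def chain_class_def
  by auto

lemma chain_class_in_carrier [simp]:
  "Poly_Mapping.keys z \<subseteq> rack_cells X n \<Longrightarrow> chain_class X n z \<in> carrier (quandle_chain_group X n)"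
  using hom_in_carrier[OF chain_class_hom, of z X n] by simp

lemma chain_class_eqI:
  assumes "Poly_Mapping.keys w \<subseteq> rack_cells X n" "d \<in> degenerate_chains X n"
  shows "chain_class X n (d + w) = chain_class X n w"
proof -
  have "d + w \<in> degenerate_chains X n #>\<^bsub>rack_chain_group X n\<^esub> w"
    using assms by (auto simp: r_coset_def rack_chain_group_def)
  then show ?thesis
    using group.repr_independence[OF _ _ _ subgroup_degenerate_chains, of X n "d + w" w] assms(1)
    by (simp add: chain_class_def rack_chain_group_def)
qed

section \<open>Cells and boundaries in degrees 1 to 3\<close>

lemma rack_cells_1: "rack_cells X 1 = {[x] |x. x \<in> carrier X}"
  by (auto simp: rack_cells_def length_Suc_conv)

lemma rack_cells_2: "rack_cells X 2 = {[x, y] |x y. x \<in> carrier X \<and> y \<in> carrier X}"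
proof -
  have "int (length xs) = 2 \<longleftrightarrow> length xs = Suc (Suc 0)" for xs :: "'a list" by auto
  then have "int (length xs) = 2 \<longleftrightarrow> (\<exists>x y. xs = [x, y])" for xs :: "'a list"
    by (auto simp: length_Suc_conv)
  then show ?thesis by (auto simp: rack_cells_def)
qed

lemma rack_cells_3:
  "rack_cells X 3 = {[x, y, z] |x y z. x \<in> carrier X \<and> y \<in> carrier X \<and> z \<in> carrier X}"
proof -
  have "int (length xs) = 3 \<longleftrightarrow> length xs = Suc (Suc (Suc 0))" for xs :: "'a list" by auto
  then have "int (length xs) = 3 \<longleftrightarrow> (\<exists>x y z. xs = [x, y, z])" for xs :: "'a list"
    by (auto simp: length_Suc_conv)
  then show ?thesis by (auto simp: rack_cells_def)
qed

lemma rack_boundary_2: "rack_boundary X (frag_of [x, y]) = frag_of [x] - frag_of [x \<triangleright>\<^bsub>X\<^esub> y]"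
  by (simp add: rack_boundary_def rack_boundary_cell_def)

text \<open>The summands i = 2 and i = 3 have opposite signs. The second stays one subtracted
  bracket, so that the rules for differences apply at each level.\<close>

lemma rack_boundary_3:
  "rack_boundary X (frag_of [x, y, z]) =
     frag_of [x, z] - frag_of [x \<triangleright>\<^bsub>X\<^esub> y, z] - (frag_of [x, y] - frag_of [x \<triangleright>\<^bsub>X\<^esub> z, y \<triangleright>\<^bsub>X\<^esub> z])"
proof -
  have "{2..3::nat} = {2, 3}" by auto
  then show ?thesis by (simp add: rack_boundary_def rack_boundary_cell_def)
qed

lemma rack_boundary_0 [simp]: "rack_boundary X 0 = 0"
  and rack_boundary_add: "rack_boundary X (a + b) = rack_boundary X a + rack_boundary X b"
  and rack_boundary_diff: "rack_boundary X (a - b) = rack_boundary X a - rack_boundary X b"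
  and rack_boundary_uminus: "rack_boundary X (- a) = - rack_boundary X a"
  by (simp_all add: rack_boundary_def frag_extend_add frag_extend_diff frag_extend_minus)

lemma keys_diff_subset:
  "\<lbrakk>Poly_Mapping.keys a \<subseteq> S; Poly_Mapping.keys b \<subseteq> S\<rbrakk> \<Longrightarrow> Poly_Mapping.keys (a - b) \<subseteq> S"
  using keys_diff[of a b] by blast

lemmas free_Abelian_group_induct' =
  free_Abelian_group_induct [consumes 1, case_names zero diff cell]

context quandle
begin

lemma rack_boundary_cell_2_3:
  assumes "n \<in> {2, 3}" "xs \<in> rack_cells X n"
  shows "Poly_Mapping.keys (rack_boundary X (frag_of xs)) \<subseteq> rack_cells X (n - 1)"
proof -
  have cell1: "Poly_Mapping.keys (frag_of [x]) \<subseteq> rack_cells X 1" if "x \<in> carrier X" for x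
    using that by (simp add: rack_cells_1)
  have cell2: "Poly_Mapping.keys (frag_of [x, y]) \<subseteq> rack_cells X 2"
    if "x \<in> carrier X" "y \<in> carrier X" for x y
    using that by (simp add: rack_cells_2)
  show ?thesis
  proof (cases "n = 2")
    case True
    then obtain x y where "xs = [x, y]" "x \<in> carrier X" "y \<in> carrier X"
      using assms by (auto simp: rack_cells_2)
    then show ?thesis
      using True cell1 by (simp add: rack_boundary_2 keys_diff_subset q_closed del: keys_single)
  next
    case False
    then have "n = 3" using assms by simp
    then obtain x y z where "xs = [x, y, z]" "x \<in> carrier X" "y \<in> carrier X" "z \<in> carrier X"
      using assms by (auto simp: rack_cells_3)
    then show ?thesis
      using \<open>n = 3\<close> cell2 by (simp add: rack_boundary_3 keys_diff_subset q_closed del: keys_single)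
  qed
qed

lemma keys_rack_boundary:
  assumes n: "n \<in> {2, 3}" and z: "Poly_Mapping.keys z \<subseteq> rack_cells X n"
  shows "Poly_Mapping.keys (rack_boundary X z) \<subseteq> rack_cells X (n - 1)"
  using z
proof (induction rule: free_Abelian_group_induct')
  case zero then show ?case by simp
next
  case (diff x y) then show ?case by (simp add: rack_boundary_diff keys_diff_subset)
next
  case (cell xs) then show ?case using rack_boundary_cell_2_3 n by blast
qed

text \<open>Idempotency makes terms cancel. Everything cancels for \<open>[x, x]\<close> and for
  \<open>[x, y, y]\<close>; for \<open>[x, x, z]\<close> a difference of two degenerate 2-cells
  remains.\<close>

lemma rack_boundary_degenerate_cell:
  assumes n: "n \<in> {2, 3}" and xs: "xs \<in> rack_cells X n" "Suc i < length xs" "xs ! i = xs ! Suc i"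
  shows "rack_boundary X (frag_of xs) \<in> degenerate_chains X (n - 1)"
proof (cases "n = 2")
  case True
  then obtain x where "xs = [x, x]" "x \<in> carrier X" using xs by (auto simp: rack_cells_2 less_Suc_eq)
  then show ?thesis by (simp add: rack_boundary_2 q_idem degenerate_chains_zero)
next
  case False
  then have [simp]: "n = 3" using n by simp
  from xs obtain x y z where xyz: "xs = [x, y, z]" "x \<in> carrier X" "y \<in> carrier X" "z \<in> carrier X"
    "x = y \<or> y = z"
    by (auto simp: rack_cells_3 less_Suc_eq)
  have deg: "frag_of [a, a] \<in> degenerate_chains X 2" if "a \<in> carrier X" for a
    using that by (auto intro!: degenerate_chainsI[where i = 0] simp: rack_cells_2)
  from xyz(5) show ?thesis
  proof
    assume "x = y"
    then have "rack_boundary X (frag_of xs) = frag_of [x \<triangleright> z, x \<triangleright> z] - frag_of [x, x]"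
      using xyz by (simp add: rack_boundary_3 q_idem)
    then show ?thesis using deg xyz by (simp add: degenerate_chains_diff q_closed)
  next
    assume "y = z"
    then show ?thesis using xyz by (simp add: rack_boundary_3 q_idem degenerate_chains_zero)
  qed
qed

lemma rack_boundary_degenerate:
  assumes n: "n \<in> {2, 3}" and d: "d \<in> degenerate_chains X n"
  shows "rack_boundary X d \<in> degenerate_chains X (n - 1)"
  using d
proof (induction rule: degenerate_chains_induct)
  case zero then show ?case by (simp add: degenerate_chains_zero)
next
  case (cell xs i) then show ?case using rack_boundary_degenerate_cell n by blast
next
  case (uminus a) then show ?case by (simp add: rack_boundary_uminus degenerate_chains_uminus)
next
  case (add a b) then show ?case by (simp add: rack_boundary_add degenerate_chains_add)
qed

text \<open>Two representatives differ by a degenerate chain, whose boundary is again degenerate.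
  The image over all representatives is therefore a singleton, as \<open>the_elem\<close>
  requires.\<close>

lemma quandle_boundary_chain_class:
  assumes n: "n \<in> {2, 3}" and z: "Poly_Mapping.keys z \<subseteq> rack_cells X n"
  shows "quandle_boundary X n (chain_class X n z) = chain_class X (n - 1) (rack_boundary X z)"
proof -
  have "(\<lambda>w. chain_class X (n - 1) (rack_boundary X w)) ` chain_class X n z =
      {chain_class X (n - 1) (rack_boundary X z)}" (is "?f ` _ = _")
  proof -
    have "?f w = ?f z" if "w \<in> chain_class X n z" for w
    proof -
      from that obtain d where d: "d \<in> degenerate_chains X n" "w = d + z"
        by (auto simp: chain_class_def r_coset_def rack_chain_group_def)
      show ?thesis
        unfolding d(2) rack_boundary_add
        by (rule chain_class_eqI[OF keys_rack_boundary[OF n z] rack_boundary_degenerate[OF n d(1)]])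
    qed
    moreover have "z \<in> chain_class X n z"
      unfolding chain_class_def
      by (rule group.rcos_self[OF _ _ subgroup_degenerate_chains]) (use z in \<open>simp_all add: rack_chain_group_def\<close>)
    ultimately show ?thesis by blast
  qed
  then show ?thesis by (simp add: quandle_boundary_def)
qed

end

section \<open>Translation between 2-cocycles and functions of two elements\<close>

lemma hom_free_Abelian_group_diff:
  assumes "group G" "h \<in> hom (free_Abelian_group S) G"
    "Poly_Mapping.keys a \<subseteq> S" "Poly_Mapping.keys b \<subseteq> S"
  shows "h (a - b) = h a \<otimes>\<^bsub>G\<^esub> inv\<^bsub>G\<^esub> h b"
proof -
  interpret group_hom "free_Abelian_group S" G h
    using assms by (simp add: group_hom_def group_hom_axioms_def)
  have "h (a + (- b)) = h a \<otimes>\<^bsub>G\<^esub> h (- b)"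
    using hom_mult[of a "- b"] assms(3,4) by simp
  moreover have "h (- b) = inv\<^bsub>G\<^esub> h b"
    using hom_inv[of b] assms(4) by simp
  ultimately show ?thesis by simp
qed

lemma cochain_chain_class_hom:
  assumes "\<phi> \<in> carrier (quandle_cochain_group X G n)"
  shows "(\<lambda>z. \<phi> (chain_class X n z)) \<in> hom (free_Abelian_group (rack_cells X n)) G"
  using hom_compose[OF chain_class_hom, of \<phi> X n G] assms
  by (simp add: quandle_cochain_group_def hom_group_def comp_def rack_chain_group_def)

lemma quandle_cocyclesD:
  assumes "\<phi> \<in> quandle_cocycles X G n"
  shows "\<phi> \<in> carrier (quandle_cochain_group X G n)"
    and "c \<in> carrier (quandle_chain_group X (n + 1)) \<Longrightarrow> \<phi> (quandle_boundary X (n + 1) c) = \<one>\<^bsub>G\<^esub>"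
proof -
  show "\<phi> \<in> carrier (quandle_cochain_group X G n)"
    using assms by (simp add: quandle_cocycles_def kernel_def)
  assume c: "c \<in> carrier (quandle_chain_group X (n + 1))"
  have "quandle_coboundary X n \<phi> = \<one>\<^bsub>quandle_cochain_group X G (n + 1)\<^esub>"
    using assms by (simp add: quandle_cocycles_def kernel_def)
  from fun_cong[OF this, of c] c show "\<phi> (quandle_boundary X (n + 1) c) = \<one>\<^bsub>G\<^esub>"
    by (simp add: quandle_coboundary_def quandle_cochain_group_def hom_group_def)
qed

text \<open>The last condition says that \<open>F\<close> is trivial on \<open>\<partial>(x, y, z)\<close>, in the form given by \<open>rack_boundary_3\<close>.\<close>

definition cocycle2_fun ::
  "('a, 'm) quandle_scheme \<Rightarrow> ('g, 'k) monoid_scheme \<Rightarrow> ('a \<Rightarrow> 'a \<Rightarrow> 'g) \<Rightarrow> bool" where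
  "cocycle2_fun X G F \<longleftrightarrow>
     (\<forall>x\<in>carrier X. \<forall>y\<in>carrier X. F x y \<in> carrier G) \<and>
     (\<forall>x\<in>carrier X. F x x = \<one>\<^bsub>G\<^esub>) \<and>
     (\<forall>x\<in>carrier X. \<forall>y\<in>carrier X. \<forall>z\<in>carrier X.
        F x z \<otimes>\<^bsub>G\<^esub> inv\<^bsub>G\<^esub> F (x \<triangleright>\<^bsub>X\<^esub> y) z
          \<otimes>\<^bsub>G\<^esub> inv\<^bsub>G\<^esub> (F x y \<otimes>\<^bsub>G\<^esub> inv\<^bsub>G\<^esub> F (x \<triangleright>\<^bsub>X\<^esub> z) (y \<triangleright>\<^bsub>X\<^esub> z)) = \<one>\<^bsub>G\<^esub>)"

lemma (in quandle) hom_rack_boundary_3: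
  assumes "group G" and h: "h \<in> hom (free_Abelian_group (rack_cells X 2)) G"
    and "x \<in> carrier X" "y \<in> carrier X" "z \<in> carrier X"
  shows "h (rack_boundary X (frag_of [x, y, z])) =
    h (frag_of [x, z]) \<otimes>\<^bsub>G\<^esub> inv\<^bsub>G\<^esub> h (frag_of [x \<triangleright> y, z])
      \<otimes>\<^bsub>G\<^esub> inv\<^bsub>G\<^esub> (h (frag_of [x, y]) \<otimes>\<^bsub>G\<^esub> inv\<^bsub>G\<^esub> h (frag_of [x \<triangleright> z, y \<triangleright> z]))"
proof -
  have c: "Poly_Mapping.keys (frag_of [a, b]) \<subseteq> rack_cells X 2" if "a \<in> carrier X" "b \<in> carrier X" for a b
    using that by (simp add: rack_cells_2)
  note c4 = c[OF assms(3,5)] c[OF q_closed[OF assms(3,4)] assms(5)]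
    c[OF assms(3,4)] c[OF q_closed[OF assms(3,5)] q_closed[OF assms(4,5)]]
  note d = hom_free_Abelian_group_diff[OF assms(1) h]
  show ?thesis
    unfolding rack_boundary_3 d[OF keys_diff_subset[OF c4(1,2)] keys_diff_subset[OF c4(3,4)]]
      d[OF c4(1,2)] d[OF c4(3,4)] ..
qed

text \<open>The cell \<open>[x, x]\<close> lies in the identity class, so its value is trivial; the
  cocycle identity is triviality on the boundary of \<open>[x, y, z]\<close>.\<close>

lemma (in quandle) cocycle2_fun_cochain2_value:
  assumes G: "group G" and \<phi>: "\<phi> \<in> quandle_cocycles X G 2"
  shows "cocycle2_fun X G (cochain2_value X \<phi>)"
proof -
  let ?h = "\<lambda>z. \<phi> (chain_class X 2 z)"
  have h: "?h \<in> hom (free_Abelian_group (rack_cells X 2)) G"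
    by (rule cochain_chain_class_hom[OF quandle_cocyclesD(1)[OF \<phi>]])
  have cell: "Poly_Mapping.keys (frag_of [a, b]) \<subseteq> rack_cells X 2" if "a \<in> carrier X" "b \<in> carrier X" for a b
    using that by (simp add: rack_cells_2)
  have "?h (frag_of [x, y]) \<in> carrier G" if "x \<in> carrier X" "y \<in> carrier X" for x y
    using hom_in_carrier[OF h] cell that by simp
  moreover have "?h (frag_of [x, x]) = \<one>\<^bsub>G\<^esub>" if "x \<in> carrier X" for x
  proof -
    have "frag_of [x, x] \<in> degenerate_chains X 2"
      using that by (auto intro!: degenerate_chainsI[where i = 0] simp: rack_cells_2)
    then have "chain_class X 2 (frag_of [x, x]) = chain_class X 2 0"
      using chain_class_eqI[of 0 X 2] by simp
    moreover have "?h 0 = \<one>\<^bsub>G\<^esub>"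
      using hom_one[OF h] G by simp
    ultimately show ?thesis by simp
  qed
  moreover have "?h (rack_boundary X (frag_of [x, y, z])) = \<one>\<^bsub>G\<^esub>"
    if "x \<in> carrier X" "y \<in> carrier X" "z \<in> carrier X" for x y z
  proof -
    have "Poly_Mapping.keys (frag_of [x, y, z]) \<subseteq> rack_cells X 3"
      using that by (simp add: rack_cells_3)
    then show ?thesis
      using quandle_cocyclesD(2)[OF \<phi>, of "chain_class X 3 (frag_of [x, y, z])"]
        quandle_boundary_chain_class[of 3 "frag_of [x, y, z]"] by simp
  qed
  ultimately show ?thesis
    using hom_rack_boundary_3[OF G h] by (simp add: cocycle2_fun_def cochain2_value_def)
qed

text \<open>F extends from the cells to a homomorphism on 2-chains. It kills the degenerate
  generators, so it factors through the quotient, and it kills boundaries of 3-cells, hence of all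
  3-chains.\<close>

lemma (in quandle) cocycle2_fun_realised:
  assumes G: "comm_group G" and F: "cocycle2_fun X G F"
  obtains \<psi> where "\<psi> \<in> quandle_cocycles X G 2"
    "\<And>x y. \<lbrakk>x \<in> carrier X; y \<in> carrier X\<rbrakk> \<Longrightarrow> cochain2_value X \<psi> x y = F x y"
proof -
  interpret G: comm_group G by (rule G)
  have grp: "group G" ..
  have "(\<lambda>xs. F (xs ! 0) (xs ! 1)) ` rack_cells X 2 \<subseteq> carrier G"
    using F by (auto simp: rack_cells_2 cocycle2_fun_def)
  then obtain h where h: "h \<in> hom (free_Abelian_group (rack_cells X 2)) G"
    and hc: "\<And>xs. xs \<in> rack_cells X 2 \<Longrightarrow> h (frag_of xs) = F (xs ! 0) (xs ! 1)"
    by (rule G.free_Abelian_group_universal) blast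
  have hF: "h (frag_of [x, y]) = F x y" if "x \<in> carrier X" "y \<in> carrier X" for x y
    using hc[of "[x, y]"] that by (simp add: rack_cells_2)
  interpret h: group_hom "free_Abelian_group (rack_cells X 2)" G h
    using h by (simp add: group_hom_def group_hom_axioms_def grp)
  have h0: "h 0 = \<one>\<^bsub>G\<^esub>" using h.hom_one by simp
  have hdiff: "h (a - b) = h a \<otimes>\<^bsub>G\<^esub> inv\<^bsub>G\<^esub> h b"
    if "Poly_Mapping.keys a \<subseteq> rack_cells X 2" "Poly_Mapping.keys b \<subseteq> rack_cells X 2" for a b
    by (rule hom_free_Abelian_group_diff[OF grp h that])
  have "h d = \<one>\<^bsub>G\<^esub>" if "d \<in> degenerate_chains X 2" for d
    using that
  proof (induction rule: degenerate_chains_induct)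
    case zero then show ?case by (rule h0)
  next
    case (cell xs i)
    then obtain x where "xs = [x, x]" "x \<in> carrier X" by (auto simp: rack_cells_2 less_Suc_eq)
    then show ?case using hF F by (simp add: cocycle2_fun_def)
  next
    case (uminus a)
    then show ?case using hdiff[of 0 a] h0 by simp
  next
    case (add a b)
    then show ?case using h.hom_mult[of a b] by simp
  qed
  then have ker: "degenerate_chains X 2 \<subseteq> kernel (free_Abelian_group (rack_cells X 2)) G h"
    by (intro subsetI) (use degenerate_chains_keys[of _ X 2] in \<open>simp add: kernel_def\<close>)
  have norm: "degenerate_chains X 2 \<lhd> free_Abelian_group (rack_cells X 2)"
    using normal_degenerate_chains[of X 2] by (simp add: rack_chain_group_def)
  obtain g where "g \<in> hom (free_Abelian_group (rack_cells X 2) Mod degenerate_chains X 2) G"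
    and "\<And>z. z \<in> carrier (free_Abelian_group (rack_cells X 2)) \<Longrightarrow>
      g (degenerate_chains X 2 #>\<^bsub>free_Abelian_group (rack_cells X 2)\<^esub> z) = h z"
    using h.FactGroup_universal_kernel[OF norm ker] by blast
  then have g: "g \<in> hom (quandle_chain_group X 2) G"
    and gc: "\<And>z. Poly_Mapping.keys z \<subseteq> rack_cells X 2 \<Longrightarrow> g (chain_class X 2 z) = h z"
    by (simp_all add: quandle_chain_group_def chain_class_def rack_chain_group_def)
  \<comment> \<open>Cochain groups consist of extensional functions, so \<open>g\<close> is cut off
    outside the quotient group.\<close>
  let ?\<psi> = "restrict g (carrier (quandle_chain_group X 2))"
  have psi: "?\<psi> (chain_class X 2 z) = h z" if "Poly_Mapping.keys z \<subseteq> rack_cells X 2" for z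
    using gc that by simp
  have "?\<psi> \<in> carrier (quandle_cochain_group X G 2)"
    using g group_quandle_chain_group[of X 2]
    by (auto simp: quandle_cochain_group_def hom_group_def hom_def group.is_monoid monoid.m_closed)
  moreover have hd: "h (rack_boundary X z) = \<one>\<^bsub>G\<^esub>" if "Poly_Mapping.keys z \<subseteq> rack_cells X 3" for z
    using that
  proof (induction rule: free_Abelian_group_induct')
    case zero then show ?case by (simp add: h0)
  next
    case (diff a b)
    then show ?case
      using hdiff keys_rack_boundary[of 3] by (simp add: rack_boundary_diff)
  next
    case (cell xs)
    then obtain x y z where "xs = [x, y, z]" "x \<in> carrier X" "y \<in> carrier X" "z \<in> carrier X"
      by (auto simp: rack_cells_3)
    then show ?case
      using hom_rack_boundary_3[OF grp h, of x y z] F by (simp add: hF q_closed cocycle2_fun_def)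
  qed
  have "?\<psi> (quandle_boundary X 3 c) = \<one>\<^bsub>G\<^esub>" if c: "c \<in> carrier (quandle_chain_group X 3)" for c
  proof -
    obtain z where "Poly_Mapping.keys z \<subseteq> rack_cells X 3" "c = chain_class X 3 z"
      by (rule quandle_chain_group_carrierE[OF c])
    then show ?thesis
      using psi[of "rack_boundary X z"] keys_rack_boundary[of 3 z] quandle_boundary_chain_class[of 3 z] hd
      by simp
  qed
  then have "quandle_coboundary X 2 ?\<psi> = \<one>\<^bsub>quandle_cochain_group X G 3\<^esub>"
    unfolding quandle_coboundary_def quandle_cochain_group_def hom_group_def
    by (simp cong: restrict_cong)
  ultimately have "?\<psi> \<in> quandle_cocycles X G 2"
    by (simp add: quandle_cocycles_def kernel_def)
  moreover have "cochain2_value X ?\<psi> x y = F x y" if "x \<in> carrier X" "y \<in> carrier X" for x y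
    unfolding cochain2_value_def using psi[of "frag_of [x, y]"] hF[OF that] that
    by (simp add: rack_cells_2 del: restrict_apply)
  ultimately show ?thesis by (rule that)
qed

text \<open>The function f is a 1-cochain evaluated on one-element cells; the order of the quotient
  follows the boundary \<open>[x] - [x \<triangleright> y]\<close>.\<close>

lemma (in quandle) coboundary2_value:
  assumes G: "group G" and \<psi>: "\<psi> \<in> quandle_coboundaries X G 2"
  obtains f where "f \<in> carrier X \<rightarrow> carrier G"
    "\<And>x y. \<lbrakk>x \<in> carrier X; y \<in> carrier X\<rbrakk> \<Longrightarrow>
      cochain2_value X \<psi> x y = f x \<otimes>\<^bsub>G\<^esub> inv\<^bsub>G\<^esub> f (x \<triangleright> y)"
proof -
  obtain \<xi> where \<xi>: "\<xi> \<in> carrier (quandle_cochain_group X G 1)" and eq: "\<psi> = quandle_coboundary X 1 \<xi>"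
    using \<psi> by (auto simp: quandle_coboundaries_def)
  let ?h = "\<lambda>z. \<xi> (chain_class X 1 z)"
  have h: "?h \<in> hom (free_Abelian_group (rack_cells X 1)) G"
    by (rule cochain_chain_class_hom[OF \<xi>])
  have cell: "Poly_Mapping.keys (frag_of [x]) \<subseteq> rack_cells X 1" if "x \<in> carrier X" for x
    using that by (simp add: rack_cells_1)
  show ?thesis
  proof
    show "(\<lambda>x. ?h (frag_of [x])) \<in> carrier X \<rightarrow> carrier G"
      using hom_in_carrier[OF h] cell by simp
  next
    fix x y assume xy: "x \<in> carrier X" "y \<in> carrier X"
    then have "Poly_Mapping.keys (frag_of [x, y]) \<subseteq> rack_cells X 2" by (simp add: rack_cells_2)
    then have "cochain2_value X \<psi> x y = ?h (rack_boundary X (frag_of [x, y]))"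
      using quandle_boundary_chain_class[of 2 "frag_of [x, y]"]
      by (simp add: cochain2_value_def eq quandle_coboundary_def)
    then show "cochain2_value X \<psi> x y = ?h (frag_of [x]) \<otimes>\<^bsub>G\<^esub> inv\<^bsub>G\<^esub> ?h (frag_of [x \<triangleright> y])"
      using hom_free_Abelian_group_diff[OF G h cell cell, of x "x \<triangleright> y"] xy
      by (simp add: rack_boundary_2 q_closed)
  qed
qed

text \<open>Ensures that a cocycle lies in its own coset of the coboundaries. The trivial 1-cochain
  is \<open>undefined\<close> outside the chain group, hence the check that
  \<open>quandle_boundary\<close> lands inside.\<close>

lemma (in quandle) trivial_cochain_coboundary:
  assumes "group G"
  shows "\<one>\<^bsub>quandle_cochain_group X G 2\<^esub> \<in> quandle_coboundaries X G 2"
proof -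
  have 1: "\<one>\<^bsub>quandle_cochain_group X G 1\<^esub> \<in> carrier (quandle_cochain_group X G 1)"
    using assms group_quandle_chain_group[of X 1]
    by (auto simp: quandle_cochain_group_def hom_group_def hom_def group.is_monoid monoid.m_closed)
  have "quandle_boundary X 2 c \<in> carrier (quandle_chain_group X 1)" if c: "c \<in> carrier (quandle_chain_group X 2)" for c
  proof -
    obtain z where "Poly_Mapping.keys z \<subseteq> rack_cells X 2" "c = chain_class X 2 z"
      by (rule quandle_chain_group_carrierE[OF c])
    then show ?thesis
      using quandle_boundary_chain_class[of 2 z] keys_rack_boundary[of 2 z] by simp
  qed
  then have "quandle_coboundary X 1 \<one>\<^bsub>quandle_cochain_group X G 1\<^esub> = \<one>\<^bsub>quandle_cochain_group X G 2\<^esub>"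
    by (simp add: quandle_coboundary_def quandle_cochain_group_def hom_group_def cong: restrict_cong)
  then show ?thesis
    using 1 by (force simp: quandle_coboundaries_def)
qed

text \<open>The coset of \<open>\<psi>\<close> is an element of the cohomology group, hence its
  identity, which is the set of coboundaries itself. As this set contains the trivial cochain, the
  coset contains \<open>\<psi>\<close>.\<close>

lemma (in quandle) cocycle_is_coboundary:
  assumes G: "group G" and \<psi>: "\<psi> \<in> quandle_cocycles X G 2"
    and triv: "carrier (quandle_cohomology_group X G 2) = {\<one>\<^bsub>quandle_cohomology_group X G 2\<^esub>}"
  shows "\<psi> \<in> quandle_coboundaries X G 2"
proof -
  let ?A = "quandle_cochain_group X G 2 \<lparr>carrier := quandle_cocycles X G 2\<rparr>"
  let ?B = "quandle_coboundaries X G 2"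
  have "?B #>\<^bsub>?A\<^esub> \<psi> \<in> carrier (quandle_cohomology_group X G 2)"
    using \<psi> by (auto simp: quandle_cohomology_group_def FactGroup_def RCOSETS_def)
  then have "?B #>\<^bsub>?A\<^esub> \<psi> = ?B"
    using triv by (simp add: quandle_cohomology_group_def FactGroup_def)
  moreover have "\<one>\<^bsub>quandle_cochain_group X G 2\<^esub> \<otimes>\<^bsub>?A\<^esub> \<psi> = \<psi>"
  proof -
    have c: "\<psi> \<in> carrier (quandle_cochain_group X G 2)" by (rule quandle_cocyclesD(1)[OF \<psi>])
    then have "\<psi> x \<in> carrier G" if "x \<in> carrier (quandle_chain_group X 2)" for x
      using that by (auto simp: quandle_cochain_group_def hom_group_def hom_def)
    then show ?thesis
      using c G by (auto simp: quandle_cochain_group_def hom_group_def fun_eq_iff extensional_def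
        group.is_monoid monoid.l_one)
  qed
  ultimately show ?thesis
    using trivial_cochain_coboundary[OF G] by (force simp: r_coset_def)
qed

lemma (in quandle) cocycle2_fun_pullback:
  assumes hom: "\<pi> \<in> quandle_hom X Y" and F: "cocycle2_fun Y G F"
  shows "cocycle2_fun X G (\<lambda>x y. F (\<pi> x) (\<pi> y))"
proof -
  have "\<pi> x \<in> carrier Y" if "x \<in> carrier X" for x
    using hom that by (auto simp: quandle_hom_def)
  moreover have "\<pi> (x \<triangleright> y) = \<pi> x \<triangleright>\<^bsub>Y\<^esub> \<pi> y" if "x \<in> carrier X" "y \<in> carrier X" for x y
    using hom that by (simp add: quandle_hom_def)
  ultimately show ?thesis using F by (simp add: cocycle2_fun_def)
qed

section \<open>Local homogeneity\<close>

text \<open>Preimages stay in the fibre: if y = c * b with y and b over u = f a, then f c * u = u =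
  u * u, and unique division in \<open>Y\<close> gives f c = u.\<close>

lemma right_mult_Bij_equalizer:
  assumes X: "quandle X" and Y: "quandle Y" and hom: "f \<in> quandle_hom X Y"
    and a: "a \<in> carrier X" and b: "b \<in> carrier (equalizer X f a)"
  shows "right_mult (equalizer X f a) b \<in> Bij (carrier (equalizer X f a))"
proof -
  interpret X: quandle X by (rule X)
  interpret Y: quandle Y by (rule Y)
  let ?E = "{x \<in> carrier X. f x = f a}"
  have b': "b \<in> carrier X" "f b = f a" using b by (simp_all add: equalizer_def)
  have fa: "f x \<in> carrier Y" if "x \<in> carrier X" for x
    using hom that by (auto simp: quandle_hom_def)
  have fop: "f (x \<triangleright>\<^bsub>X\<^esub> b) = f x \<triangleright>\<^bsub>Y\<^esub> f a" if "x \<in> carrier X" for x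
    using hom that b' by (simp add: quandle_hom_def)
  have "\<exists>!c. c \<in> ?E \<and> y = c \<triangleright>\<^bsub>X\<^esub> b" if y: "y \<in> ?E" for y
  proof -
    obtain c where c: "c \<in> carrier X" "y = c \<triangleright>\<^bsub>X\<^esub> b"
      and uni: "\<And>c'. \<lbrakk>c' \<in> carrier X; y = c' \<triangleright>\<^bsub>X\<^esub> b\<rbrakk> \<Longrightarrow> c' = c"
      using X.q_unique[of y b] y b' by auto
    have "f a = f c \<triangleright>\<^bsub>Y\<^esub> f a" using fop c y by simp
    moreover have "f a = f a \<triangleright>\<^bsub>Y\<^esub> f a" using Y.q_idem fa a by simp
    ultimately have "f c = f a" using Y.q_unique[OF fa[OF a] fa[OF a]] fa a c by blast
    then show ?thesis using c uni by blast
  qed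
  moreover have "x \<triangleright>\<^bsub>X\<^esub> b \<in> ?E" if "x \<in> ?E" for x
    using that X.q_closed b' fop Y.q_idem fa a by simp
  ultimately have "bij_betw (\<lambda>x. x \<triangleright>\<^bsub>X\<^esub> b) ?E ?E"
    unfolding bij_betw_def inj_on_def by blast
  then have "bij_betw (right_mult (equalizer X f a) b) ?E ?E"
    by (rule bij_betw_cong[THEN iffD1, rotated]) (simp add: right_mult_def equalizer_def)
  then show ?thesis by (simp add: Bij_def right_mult_def equalizer_def)
qed

text \<open>Membership in \<open>Bij\<close> is carried through the induction because products and
  inverses in \<open>BijGroup\<close> are given by \<open>compose\<close> and
  \<open>inv_into\<close> only for bijections of the carrier.\<close>

lemma inner_aut_invariant:
  fixes f :: "'a \<Rightarrow> 'c"
  assumes bij: "\<And>b. b \<in> carrier E \<Longrightarrow> right_mult E b \<in> Bij (carrier E)"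
    and inv: "\<And>x b. \<lbrakk>x \<in> carrier E; b \<in> carrier E\<rbrakk> \<Longrightarrow> f (x \<triangleright>\<^bsub>E\<^esub> b) = f x"
    and g: "g \<in> carrier (inner_aut_group E)"
  shows "g \<in> Bij (carrier E) \<and> (\<forall>x\<in>carrier E. f (g x) = f x)"
proof -
  have "g \<in> generate (BijGroup (carrier E)) (right_mult E ` carrier E)"
    using g by (simp add: inner_aut_group_def)
  then show ?thesis
  proof (induction rule: generate.induct)
    case one
    have "\<one>\<^bsub>BijGroup (carrier E)\<^esub> = (\<lambda>x\<in>carrier E. x)" by (simp add: BijGroup_def)
    then show ?case using id_Bij[of "carrier E"] by (metis restrict_apply')
  next
    case (incl h)
    then show ?case using bij inv by (auto simp: right_mult_def)
  next
    case (inv h)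
    then obtain b where b: "b \<in> carrier E" "h = right_mult E b" by blast
    then have h: "h \<in> Bij (carrier E)" using bij by blast
    have "f (inv_into (carrier E) h x) = f x" if x: "x \<in> carrier E" for x
    proof -
      \<comment> \<open>Since \<open>h ?y = x\<close>, invariance under \<open>h\<close> at
        \<open>?y\<close> is invariance under the inverse at \<open>x\<close>.\<close>
      let ?y = "inv_into (carrier E) h x"
      have y: "?y \<in> carrier E" using Bij_inv_into_mem h x by fast
      have "h ?y = x" using h x by (auto simp: Bij_def bij_betw_def intro: f_inv_into_f)
      then show ?thesis using assms(2)[OF y b(1)] b y by (simp add: right_mult_def)
    qed
    then show ?case
      unfolding inv_BijGroup[OF h] using restrict_inv_into_Bij[OF h] by (metis restrict_apply')
  next
    case (eng h1 h2)
    have "h2 x \<in> carrier E" if "x \<in> carrier E" for x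
      using Bij_imp_funcset eng that by blast
    moreover have "h1 \<otimes>\<^bsub>BijGroup (carrier E)\<^esub> h2 = compose (carrier E) h1 h2"
      using eng by (simp add: BijGroup_def)
    ultimately show ?case using eng compose_Bij[of h1 "carrier E" h2] by (simp add: compose_eq)
  qed
qed

text \<open>A single orbit contains both points, so some inner automorphism carries \<open>x\<close>
  to \<open>y\<close>.\<close>

lemma homogeneous_invariant_constant:
  assumes "homogeneous E"
    and "\<And>b. b \<in> carrier E \<Longrightarrow> right_mult E b \<in> Bij (carrier E)"
    and "\<And>x b. \<lbrakk>x \<in> carrier E; b \<in> carrier E\<rbrakk> \<Longrightarrow> f (x \<triangleright>\<^bsub>E\<^esub> b) = f x"
    and xy: "x \<in> carrier E" "y \<in> carrier E"
  shows "f x = f y"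
proof -
  let ?I = "inner_aut_group E"
  have "orbit ?I (\<lambda>f. f) x = orbit ?I (\<lambda>f. f) y"
    using assms(1) xy unfolding homogeneous_def orbits_def by blast
  moreover have "y \<in> orbit ?I (\<lambda>f. f) y"
  proof -
    \<comment> \<open>The identity of \<open>BijGroup\<close> is extensional, so the identity map
      appears restricted to the carrier.\<close>
    have "(\<lambda>x\<in>carrier E. x) \<in> carrier ?I"
      using generate.one[of "BijGroup (carrier E)"] by (simp add: inner_aut_group_def BijGroup_def)
    then show ?thesis using xy unfolding orbit_def by (force intro: exI[where x = "\<lambda>x\<in>carrier E. x"])
  qed
  ultimately obtain g where "g \<in> carrier ?I" "y = g x" unfolding orbit_def by blast
  then show ?thesis using inner_aut_invariant[of E f g] assms(2,3) xy by simp
qed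

lemma locally_homogeneous_descent:
  assumes X: "quandle X" and Y: "quandle Y"
    and hom: "\<pi> \<in> quandle_hom X Y" and surj: "\<pi> ` carrier X = carrier Y"
    and lh: "locally_homogeneous X \<pi>"
    and f: "\<And>x b. \<lbrakk>x \<in> carrier X; b \<in> carrier X; \<pi> b = \<pi> x\<rbrakk> \<Longrightarrow> f (x \<triangleright>\<^bsub>X\<^esub> b) = f x"
  obtains g where "\<And>x. x \<in> carrier X \<Longrightarrow> f x = g (\<pi> x)"
proof -
  have const: "f x = f y" if xy: "x \<in> carrier X" "y \<in> carrier X" "\<pi> x = \<pi> y" for x y
  proof -
    let ?E = "equalizer X \<pi> x"
    have "homogeneous ?E" using lh xy(1) by (simp add: locally_homogeneous_def)
    moreover have "right_mult ?E b \<in> Bij (carrier ?E)" if "b \<in> carrier ?E" for b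
      by (rule right_mult_Bij_equalizer[OF X Y hom xy(1) that])
    moreover have "f (u \<triangleright>\<^bsub>?E\<^esub> b) = f u" if "u \<in> carrier ?E" "b \<in> carrier ?E" for u b
      using that f[of u b] by (simp add: equalizer_def)
    moreover have "x \<in> carrier ?E" "y \<in> carrier ?E" using xy by (simp_all add: equalizer_def)
    ultimately show ?thesis by (rule homogeneous_invariant_constant[where f = f])
  qed
  \<comment> \<open>\<open>inv_into\<close> picks a point in each fibre; by \<open>const\<close> the
    choice does not affect the value of \<open>f\<close>.\<close>
  have "f x = f (inv_into (carrier X) \<pi> (\<pi> x))" if "x \<in> carrier X" for x
    using const[of x "inv_into (carrier X) \<pi> (\<pi> x)"] that
    by (simp add: inv_into_into f_inv_into_f)
  then show ?thesis using that[of "\<lambda>u. f (inv_into (carrier X) \<pi> u)"] by blast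
qed

section \<open>Arcs of a diagram\<close>

text \<open>Meant for the undercrossing parameters on one closed curve. The second case is the
  wrap-around from the largest element to the least; it covers one-element sets, where
  \<open>\<sigma>\<close> fixes the point. The empty intervals later certify that a strand meets no
  undercrossing.\<close>

definition cyclic_successor :: "'a::linorder set \<Rightarrow> ('a \<Rightarrow> 'a) \<Rightarrow> bool" where
  "cyclic_successor T \<sigma> \<longleftrightarrow> bij_betw \<sigma> T T \<and>
     (\<forall>t\<in>T. (t < \<sigma> t \<and> T \<inter> {t<..<\<sigma> t} = {}) \<or>
       (\<sigma> t \<le> t \<and> T \<inter> {t<..} = {} \<and> T \<inter> {..<\<sigma> t} = {}))"

lemma cyclic_successor_exists:
  assumes fin: "finite T"
  shows "\<exists>\<sigma>. cyclic_successor T \<sigma>"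
proof -
  define \<sigma> where "\<sigma> t = (if T \<inter> {t<..} = {} then Min T else Min (T \<inter> {t<..}))" for t
  have later: "\<sigma> t \<in> T" "t < \<sigma> t" "T \<inter> {t<..<\<sigma> t} = {}" if "T \<inter> {t<..} \<noteq> {}" for t
  proof -
    have "\<sigma> t \<in> T \<inter> {t<..}"
      using Min_in[of "T \<inter> {t<..}"] fin that by (simp add: \<sigma>_def)
    then show "\<sigma> t \<in> T" "t < \<sigma> t" by auto
    show "T \<inter> {t<..<\<sigma> t} = {}"
    proof (rule equals0I)
      fix u assume u: "u \<in> T \<inter> {t<..<\<sigma> t}"
      then have "\<sigma> t \<le> u" using Min_le[of "T \<inter> {t<..}" u] fin that by (simp add: \<sigma>_def)
      with u show False by (simp add: leD)
    qed
  qed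
  have wrap: "\<sigma> t \<in> T" "\<sigma> t \<le> t" "T \<inter> {..<\<sigma> t} = {}" if "t \<in> T" "T \<inter> {t<..} = {}" for t
  proof -
    have eq: "\<sigma> t = Min T" using that by (simp add: \<sigma>_def)
    show "\<sigma> t \<in> T" using that Min_in[OF fin] eq by auto
    show "\<sigma> t \<le> t" using that Min_le[OF fin] eq by simp
    show "T \<inter> {..<\<sigma> t} = {}" using Min_le[OF fin] eq by (auto simp: not_less disjoint_iff)
  qed
  \<comment> \<open>Injectivity: for s < t the successor of s is above s and at most t, whereas that
    of t is beyond t or, after wrapping around, at most s.\<close>
  have ne: "\<sigma> s \<noteq> \<sigma> t" if "s \<in> T" "t \<in> T" "s < t" for s t
  proof -
    have s: "T \<inter> {s<..} \<noteq> {}" using that by auto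
    then have le: "s < \<sigma> s" "\<sigma> s \<le> t" using later[of s] that by force+
    show ?thesis
    proof (cases "T \<inter> {t<..} = {}")
      case True
      then show ?thesis using wrap(3)[of t] that le by fastforce
    next
      case False
      then show ?thesis using later(2)[of t] le by simp
    qed
  qed
  have "inj_on \<sigma> T" by (rule linorder_inj_onI') (use ne in blast)
  moreover have "\<sigma> ` T \<subseteq> T" using later(1) wrap(1) by blast
  ultimately have "bij_betw \<sigma> T T" using fin endo_inj_surj by (metis bij_betw_def)
  moreover have "(t < \<sigma> t \<and> T \<inter> {t<..<\<sigma> t} = {}) \<or>
      (\<sigma> t \<le> t \<and> T \<inter> {t<..} = {} \<and> T \<inter> {..<\<sigma> t} = {})" if "t \<in> T" for t
    using later(2,3)[of t] wrap(2,3)[OF that] by satx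
  ultimately have "cyclic_successor T \<sigma>"
    by (simp only: cyclic_successor_def) simp
  then show ?thesis by (rule exI[of _ \<sigma>])
qed

lemma periodic_frac:
  assumes "\<And>t::real. \<gamma> (t + 1) = \<gamma> t"
  shows "\<gamma> (frac t) = \<gamma> t"
proof -
  have plus: "\<gamma> (t + real n) = \<gamma> t" for t n
  proof (induction n)
    case (Suc n)
    then show ?case using assms[of "t + real n"] by (simp add: algebra_simps)
  qed simp
  have "\<gamma> (t + of_int k) = \<gamma> t" for t k
  proof (cases "k \<ge> 0")
    case True
    then show ?thesis using plus[of t "nat k"] by simp
  next
    case False
    then show ?thesis using plus[of "t + of_int k" "nat (- k)"] by simp
  qed
  from this[of "frac t" "\<lfloor>t\<rfloor>"] show ?thesis by (simp add: frac_def)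
qed

locale diagram =
  fixes D :: curves
  assumes diagram: "link_diagram D"
begin

lemma oriented: "oriented_link D"
  and finite_crossings: "finite (crossings D)"
  using diagram by (simp_all add: link_diagram_def)

lemma inj_pt: "inj_on (pt D) (params D)"
  using oriented by (simp add: oriented_link_def)

lemma periodic: "i < length D \<Longrightarrow> (D ! i) (t + 1) = (D ! i) t"
  using oriented nth_mem unfolding oriented_link_def by blast

lemma continuous: "i < length D \<Longrightarrow> continuous_on UNIV (D ! i)"
  using oriented nth_mem C1_differentiable_imp_continuous_on unfolding oriented_link_def by blast

lemma triple_point_free:
  "\<lbrakk>a \<in> params D; b \<in> params D; c \<in> params D; proj (pt D a) = proj (pt D b);
    proj (pt D b) = proj (pt D c)\<rbrakk> \<Longrightarrow> a = b \<or> b = c \<or> a = c"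
  using diagram unfolding link_diagram_def by blast

lemma pt_frac: "i < length D \<Longrightarrow> pt D (i, frac t) = pt D (i, t)"
  using periodic_frac[of "D ! i" t] periodic by (simp add: pt_def)

text \<open>Two strands over the same under-point would form a triple point. Crossings can therefore
  be indexed by their under-parameters.\<close>

lemma inj_snd_crossings: "inj_on snd (crossings D)"
proof (rule inj_onI)
  fix \<tau> \<tau>' assume "\<tau> \<in> crossings D" "\<tau>' \<in> crossings D" "snd \<tau> = snd \<tau>'"
  moreover obtain a b where "\<tau> = (a, b)" by (rule prod.exhaust)
  moreover obtain a' b' where "\<tau>' = (a', b')" by (rule prod.exhaust)
  ultimately show "\<tau> = \<tau>'" using triple_point_free[of a b a'] by (force simp: crossings_def)
qed

lemma arc_eq:
  assumes "A \<in> arcs D" "A' \<in> arcs D" "x \<in> A" "x \<in> A'"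
  shows "A = A'"
  using assms components_nonoverlap unfolding arcs_def by blast

text \<open>The over-point is not removed from the broken curves: otherwise, by embeddedness, its
  parameter would be the under-parameter of a further crossing, and three strands would project to
  one point.\<close>

lemma over_arc_in_arcs:
  assumes "\<tau> \<in> crossings D"
  shows "over_arc D \<tau> \<in> arcs D"
proof -
  obtain a b where \<tau>: "\<tau> = (a, b)" by (rule prod.exhaust)
  have "pt D a \<notin> pt D ` snd ` crossings D"
  proof
    assume "pt D a \<in> pt D ` snd ` crossings D"
    then obtain c a' where c: "(c, a') \<in> crossings D" "pt D a = pt D a'" by force
    then have "a = a'" using inj_pt assms by (auto simp: \<tau> crossings_def dest: inj_onD)
    then show False using triple_point_free[of c a b] c assms by (auto simp: \<tau> crossings_def)
  qed
  then have "pt D a \<in> broken_curves D"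
    using assms by (auto simp: \<tau> crossings_def broken_curves_def)
  then obtain A where A: "A \<in> arcs D" "pt D a \<in> A"
    unfolding arcs_def using Union_components by blast
  then have "over_arc D \<tau> = A"
    unfolding over_arc_def \<tau> prod.case by (intro the_equality) (use arc_eq in blast)+
  then show ?thesis using A by simp
qed

text \<open>The filter \<open>at_right t\<close> is nontrivial, so two candidate arcs share a point
  and, being components, coincide.\<close>

lemma under_arc_out_eq:
  assumes "A \<in> arcs D" "\<forall>\<^sub>F r in at_right t. pt D (j, r) \<in> A"
  shows "under_arc_out D (a, (j, t)) = A"
proof -
  have "A' = A" if "A' \<in> arcs D" "\<forall>\<^sub>F r in at_right t. pt D (j, r) \<in> A'" for A'
  proof -
    have "\<exists>r. pt D (j, r) \<in> A \<and> pt D (j, r) \<in> A'"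
      by (rule eventually_happens'[OF _ eventually_conj[OF assms(2) that(2)]]) simp
    then show ?thesis using arc_eq assms(1) that(1) by blast
  qed
  then show ?thesis
    unfolding under_arc_out_def prod.case by (intro the_equality) (use assms in blast)+
qed

lemma under_arc_in_eq:
  assumes "A \<in> arcs D" "\<forall>\<^sub>F r in at_left t. pt D (j, r) \<in> A"
  shows "under_arc_in D (a, (j, t)) = A"
proof -
  have "A' = A" if "A' \<in> arcs D" "\<forall>\<^sub>F r in at_left t. pt D (j, r) \<in> A'" for A'
  proof -
    have "\<exists>r. pt D (j, r) \<in> A \<and> pt D (j, r) \<in> A'"
      by (rule eventually_happens'[OF _ eventually_conj[OF assms(2) that(2)]]) simp
    then show ?thesis using arc_eq assms(1) that(1) by blast
  qed
  then show ?thesis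
    unfolding under_arc_in_def prod.case by (intro the_equality) (use assms in blast)+
qed

text \<open>A connected image lies in one component. The endpoints may be any reals, and
  undercrossings are tested through \<open>frac\<close>, so that a strand can pass the base point of
  its closed curve.\<close>

lemma strand_in_arc:
  assumes j: "j < length D" and st: "s < t"
    and free: "\<And>r. \<lbrakk>s < r; r < t\<rbrakk> \<Longrightarrow> (j, frac r) \<notin> snd ` crossings D"
  obtains A where "A \<in> arcs D" "\<And>r. \<lbrakk>s < r; r < t\<rbrakk> \<Longrightarrow> pt D (j, r) \<in> A"
proof -
  let ?S = "(D ! j) ` {s<..<t}"
  have "pt D (j, r) \<in> broken_curves D" if r: "s < r" "r < t" for r
  proof -
    have in_params: "(j, frac r) \<in> params D"
      using j by (simp add: params_def frac_lt_1)
    have "pt D (j, frac r) \<notin> pt D ` snd ` crossings D"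
    proof
      assume "pt D (j, frac r) \<in> pt D ` snd ` crossings D"
      then obtain b where b: "b \<in> snd ` crossings D" "pt D (j, frac r) = pt D b" by blast
      then have "b \<in> params D" by (auto simp: crossings_def)
      then have "b = (j, frac r)" using inj_onD[OF inj_pt b(2) in_params] by simp
      then show False using free[OF r] b by simp
    qed
    then show ?thesis using in_params pt_frac[OF j, of r] unfolding broken_curves_def by (metis DiffI imageI)
  qed
  then have "?S \<subseteq> broken_curves D" by (auto simp: pt_def)
  moreover have "connected ?S"
    by (intro connected_continuous_image continuous_on_subset[OF continuous[OF j]]) auto
  moreover have "?S \<noteq> {}" using st by simp
  ultimately obtain A where "A \<in> components (broken_curves D)" "?S \<subseteq> A"
    using exists_component_superset[of ?S "broken_curves D"] by blast
  then show ?thesis using that[of A] unfolding arcs_def by (auto simp: pt_def image_subset_iff)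
qed

text \<open>Following the orientation, \<open>\<sigma>\<close> moves from each undercrossing to the next one on the same
  component, so the arc that leaves the former is the arc that enters the latter.\<close>

lemma consecutive_under_arcs:
  obtains \<sigma> where "bij_betw \<sigma> (crossings D) (crossings D)"
    "\<And>\<tau>. \<tau> \<in> crossings D \<Longrightarrow>
       under_arc_out D \<tau> \<in> arcs D \<and> under_arc_in D (\<sigma> \<tau>) = under_arc_out D \<tau>"
proof -
  define U where "U = snd ` crossings D"
  define T where "T j = {t. (j, t) \<in> U}" for j
  have U: "U \<subseteq> params D" by (auto simp: U_def crossings_def)
  have finU: "finite U" by (simp add: U_def finite_crossings)
  have T01: "T j \<subseteq> {0..<1}" for j using U by (auto simp: T_def params_def)
  have "\<exists>\<sigma>. cyclic_successor (T j) \<sigma>" for j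
  proof -
    have "T j = Pair j -` U" by (auto simp: T_def)
    then show ?thesis
      using finite_vimageI[OF finU, of "Pair j"] cyclic_successor_exists by (simp add: inj_on_def)
  qed
  then obtain \<sigma> where \<sigma>: "\<And>j. cyclic_successor (T j) (\<sigma> j)" by metis
  then have bij: "bij_betw (\<sigma> j) (T j) (T j)" for j by (simp add: cyclic_successor_def)
  have succ: "(t < \<sigma> j t \<and> T j \<inter> {t<..<\<sigma> j t} = {}) \<or>
       (\<sigma> j t \<le> t \<and> T j \<inter> {t<..} = {} \<and> T j \<inter> {..<\<sigma> j t} = {})" if "t \<in> T j" for j t
    using \<sigma>[of j] that unfolding cyclic_successor_def by blast
  \<comment> \<open>All closed curves are treated at once: \<open>\<nu>\<close> moves the parameter
    and keeps the index of the curve.\<close>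
  define \<nu> where "\<nu> = (\<lambda>(j, t). (j, \<sigma> j t))"
  have arcs_next: "\<exists>A\<in>arcs D. (\<forall>\<^sub>F r in at_right t. pt D (j, r) \<in> A) \<and>
      (\<forall>\<^sub>F r in at_left (\<sigma> j t). pt D (j, r) \<in> A)" if jt: "(j, t) \<in> U" for j t
  proof -
    have j: "j < length D" and t: "t \<in> T j" "0 \<le> t" "t < 1"
      using jt U by (auto simp: T_def params_def)
    have s: "\<sigma> j t \<in> T j" using bij t by (auto simp: bij_betw_def)
    then have s01: "0 \<le> \<sigma> j t" "\<sigma> j t < 1" using T01 by force+
    have fr: "frac r = r" if "0 \<le> r" "r < 1" for r :: real using that by (simp add: frac_eq)
    from succ[OF t(1)] show ?thesis
    proof
      assume *: "t < \<sigma> j t \<and> T j \<inter> {t<..<\<sigma> j t} = {}"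
      have "(j, frac r) \<notin> snd ` crossings D" if "t < r" "r < \<sigma> j t" for r
        using * that fr[of r] t s01 by (auto simp: T_def U_def)
      then obtain A where A: "A \<in> arcs D" "\<And>r. \<lbrakk>t < r; r < \<sigma> j t\<rbrakk> \<Longrightarrow> pt D (j, r) \<in> A"
        using strand_in_arc[OF j, of t "\<sigma> j t"] * by blast
      have "\<forall>\<^sub>F r in at_right t. pt D (j, r) \<in> A"
        using A(2) * unfolding eventually_at_right_field by blast
      moreover have "\<forall>\<^sub>F r in at_left (\<sigma> j t). pt D (j, r) \<in> A"
        using A(2) * unfolding eventually_at_left_field by blast
      ultimately show ?thesis using A(1) by blast
    next
      assume *: "\<sigma> j t \<le> t \<and> T j \<inter> {t<..} = {} \<and> T j \<inter> {..<\<sigma> j t} = {}"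
      \<comment> \<open>On the unrolled line the undercrossing after the last one is at
        \<open>\<sigma> j t + 1\<close>, which exceeds \<open>t\<close> even if
        \<open>\<sigma> j t = t\<close>.\<close>
      have lt: "t < \<sigma> j t + 1" using t s01 by simp
      have "(j, frac r) \<notin> snd ` crossings D" if r: "t < r" "r < \<sigma> j t + 1" for r
      proof (cases "r < 1")
        case True
        then show ?thesis using * r fr[of r] t by (auto simp: T_def U_def)
      next
        case False
        \<comment> \<open>Past the base point, \<open>frac r\<close> is below
          \<open>\<sigma> j t\<close>, the least element of \<open>T j\<close>.\<close>
        then have "frac r = r - 1" using frac_unique_iff[of r "r - 1"] r s01 by simp
        then show ?thesis using * r by (auto simp: T_def U_def)
      qed
      then obtain A where A: "A \<in> arcs D" "\<And>r. \<lbrakk>t < r; r < \<sigma> j t + 1\<rbrakk> \<Longrightarrow> pt D (j, r) \<in> A"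
        using strand_in_arc[OF j lt] by blast
      have "\<forall>\<^sub>F r in at_right t. pt D (j, r) \<in> A"
        unfolding eventually_at_right_field
        by (rule exI[of _ "\<sigma> j t + 1"]) (use A(2) t s01 in auto)
      \<comment> \<open>Shifting by one period turns the end of the unrolled interval into a left
        neighbourhood of \<open>\<sigma> j t\<close>.\<close>
      moreover have "pt D (j, r) \<in> A" if "t - 1 < r" "r < \<sigma> j t" for r
        using A(2)[of "r + 1"] that periodic[OF j, of r] by (simp add: pt_def)
      then have "\<forall>\<^sub>F r in at_left (\<sigma> j t). pt D (j, r) \<in> A"
        unfolding eventually_at_left_field
        by (intro exI[of _ "t - 1"]) (use t s01 in auto)
      ultimately show ?thesis using A(1) by blast
    qed
  qed
  have \<nu>: "bij_betw \<nu> U U"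
  proof -
    have "inj_on \<nu> U"
      using bij by (auto simp: \<nu>_def inj_on_def T_def bij_betw_def)
    moreover have "\<nu> ` U \<subseteq> U"
      using bij by (auto simp: \<nu>_def T_def bij_betw_def)
    ultimately show ?thesis using endo_inj_surj[OF finU] by (simp add: bij_betw_def)
  qed
  have sndU: "bij_betw snd (crossings D) U"
    using inj_snd_crossings by (simp add: U_def bij_betw_def)
  show ?thesis
  proof
    \<comment> \<open>The permutation of under-parameters is carried over to crossings by
      conjugation with \<open>snd\<close>.\<close>
    show "bij_betw (the_inv_into (crossings D) snd \<circ> (\<nu> \<circ> snd)) (crossings D) (crossings D)"
      by (rule bij_betw_trans[OF bij_betw_trans[OF sndU \<nu>] bij_betw_the_inv_into[OF sndU]])
  next
    fix \<tau> assume \<tau>: "\<tau> \<in> crossings D"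
    obtain a j t where [simp]: "\<tau> = (a, (j, t))" by (rule prod_cases3)
    have jt: "(j, t) \<in> U" using \<tau> by (force simp: U_def)
    then have "\<nu> (j, t) \<in> U" using \<nu> by (auto simp: bij_betw_def)
    then have "snd (the_inv_into (crossings D) snd (\<nu> (j, t))) = (j, \<sigma> j t)"
      using sndU by (simp add: f_the_inv_into_f_bij_betw \<nu>_def)
    then obtain a' where a': "the_inv_into (crossings D) snd (\<nu> (j, t)) = (a', (j, \<sigma> j t))"
      by (metis prod.collapse)
    from arcs_next[OF jt] obtain A where "A \<in> arcs D"
      "\<forall>\<^sub>F r in at_right t. pt D (j, r) \<in> A" "\<forall>\<^sub>F r in at_left (\<sigma> j t). pt D (j, r) \<in> A" by blast
    then show "under_arc_out D \<tau> \<in> arcs D \<and>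
      under_arc_in D ((the_inv_into (crossings D) snd \<circ> (\<nu> \<circ> snd)) \<tau>) = under_arc_out D \<tau>"
      using under_arc_out_eq[of A j t a] under_arc_in_eq[of A j "\<sigma> j t" a'] a' by simp
  qed
qed

end

section \<open>Crossing weights and the state-sum\<close>

lemma crossing_sign_normal_along:
  "crossing_sign D \<tau> = (if normal_along D \<tau> then 1 else - 1)"
  by (cases \<tau>) (simp add: crossing_sign_def normal_along_def normal_vec_def inner_complex_def algebra_simps)

text \<open>The incoming arc is the outgoing arc of the preceding undercrossing, which exists
  because the successor map is onto.\<close>

lemma (in diagram) under_arcs_in_arcs:
  assumes "\<tau> \<in> crossings D"
  shows "under_arc_in D \<tau> \<in> arcs D" "under_arc_out D \<tau> \<in> arcs D"
proof -
  obtain \<sigma> where \<sigma>: "bij_betw \<sigma> (crossings D) (crossings D)"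
    and next_arc: "\<And>\<tau>. \<tau> \<in> crossings D \<Longrightarrow>
       under_arc_out D \<tau> \<in> arcs D \<and> under_arc_in D (\<sigma> \<tau>) = under_arc_out D \<tau>"
    by (rule consecutive_under_arcs) blast
  obtain \<rho> where "\<rho> \<in> crossings D" "\<tau> = \<sigma> \<rho>"
    using \<sigma> assms unfolding bij_betw_def by blast
  then show "under_arc_in D \<tau> \<in> arcs D" using next_arc by simp
  show "under_arc_out D \<tau> \<in> arcs D" using next_arc assms by simp
qed

text \<open>This is the telescoping: reindexing along the successor permutation turns each incoming
  arc into the outgoing arc before it, on all closed curves simultaneously.\<close>

lemma (in diagram) finprod_under_arcs:
  assumes G: "comm_group G" and h: "h \<in> arcs D \<rightarrow> carrier G"
  shows "(\<Otimes>\<^bsub>G\<^esub>\<tau>\<in>crossings D. h (under_arc_in D \<tau>)) = (\<Otimes>\<^bsub>G\<^esub>\<tau>\<in>crossings D. h (under_arc_out D \<tau>))"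
proof -
  interpret G: comm_group G by (rule G)
  obtain \<sigma> where \<sigma>: "bij_betw \<sigma> (crossings D) (crossings D)"
    and next_arc: "\<And>\<tau>. \<tau> \<in> crossings D \<Longrightarrow>
       under_arc_out D \<tau> \<in> arcs D \<and> under_arc_in D (\<sigma> \<tau>) = under_arc_out D \<tau>"
    by (rule consecutive_under_arcs) blast
  have im: "\<sigma> ` crossings D = crossings D" and inj: "inj_on \<sigma> (crossings D)"
    using \<sigma> by (simp_all add: bij_betw_def)
  have "(\<Otimes>\<^bsub>G\<^esub>\<tau>\<in>crossings D. h (under_arc_in D \<tau>)) = (\<Otimes>\<^bsub>G\<^esub>\<tau>\<in>\<sigma> ` crossings D. h (under_arc_in D \<tau>))"
    by (simp add: im)
  also have "\<dots> = (\<Otimes>\<^bsub>G\<^esub>\<tau>\<in>crossings D. h (under_arc_in D (\<sigma> \<tau>)))"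
    by (rule G.finprod_reindex[OF _ inj]) (use h under_arcs_in_arcs im in auto)
  also have "\<dots> = (\<Otimes>\<^bsub>G\<^esub>\<tau>\<in>crossings D. h (under_arc_out D \<tau>))"
    by (rule G.finprod_cong') (use h next_arc in auto)
  finally show ?thesis .
qed

lemma (in diagram) coboundary_weight_product:
  assumes Y: "quandle Y" and G: "comm_group G" and g: "g \<in> carrier Y \<rightarrow> carrier G"
    and cob: "\<And>u v. \<lbrakk>u \<in> carrier Y; v \<in> carrier Y\<rbrakk> \<Longrightarrow>
      cochain2_value Y \<phi> u v = g u \<otimes>\<^bsub>G\<^esub> inv\<^bsub>G\<^esub> g (u \<triangleright>\<^bsub>Y\<^esub> v)"
    and C: "C \<in> colorings Y D"
  shows "(\<Otimes>\<^bsub>G\<^esub>\<tau>\<in>crossings D. crossing_weight Y G \<phi> D C \<tau>) = \<one>\<^bsub>G\<^esub>"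
proof -
  interpret G: comm_group G by (rule G)
  let ?h = "\<lambda>A. g (C A)"
  have CY: "C A \<in> carrier Y" if "A \<in> arcs D" for A
    using C that by (auto simp: colorings_def)
  have h: "?h \<in> arcs D \<rightarrow> carrier G" using CY g by auto
  have hin: "?h (under_arc_in D \<tau>) \<in> carrier G" and hout: "?h (under_arc_out D \<tau>) \<in> carrier G"
    if "\<tau> \<in> crossings D" for \<tau>
    using h under_arcs_in_arcs[OF that] by auto
  have weight: "crossing_weight Y G \<phi> D C \<tau> =
      ?h (under_arc_in D \<tau>) \<otimes>\<^bsub>G\<^esub> inv\<^bsub>G\<^esub> ?h (under_arc_out D \<tau>)" if \<tau>: "\<tau> \<in> crossings D" for \<tau>
  proof -
    have "under_arc_source D \<tau> \<in> arcs D"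
      using under_arcs_in_arcs[OF \<tau>] by (simp add: under_arc_source_def)
    \<comment> \<open>By the coloring rule, the product of the colors of source and over-arc is the
      color of the target.\<close>
    then have "cochain2_value Y \<phi> (C (under_arc_source D \<tau>)) (C (over_arc D \<tau>)) =
        ?h (under_arc_source D \<tau>) \<otimes>\<^bsub>G\<^esub> inv\<^bsub>G\<^esub> ?h (under_arc_target D \<tau>)"
      using cob CY over_arc_in_arcs[OF \<tau>] C \<tau> by (simp add: colorings_def)
    \<comment> \<open>At a negative crossing the source is the outgoing arc and the target the
      incoming one; the exponent -1 inverts the quotient, so both signs give the same
      expression.\<close>
    then show ?thesis
      using hin[OF \<tau>] hout[OF \<tau>]
      by (simp add: crossing_weight_def crossing_sign_normal_along under_arc_source_def under_arc_target_def
          G.int_pow_neg G.inv_mult_group)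
  qed
  have "(\<Otimes>\<^bsub>G\<^esub>\<tau>\<in>crossings D. crossing_weight Y G \<phi> D C \<tau>) =
      (\<Otimes>\<^bsub>G\<^esub>\<tau>\<in>crossings D. ?h (under_arc_in D \<tau>) \<otimes>\<^bsub>G\<^esub> inv\<^bsub>G\<^esub> ?h (under_arc_out D \<tau>))"
    by (rule G.finprod_cong') (use weight hin hout in auto)
  also have "\<dots> = (\<Otimes>\<^bsub>G\<^esub>\<tau>\<in>crossings D. ?h (under_arc_in D \<tau>))
      \<otimes>\<^bsub>G\<^esub> (\<Otimes>\<^bsub>G\<^esub>\<tau>\<in>crossings D. inv\<^bsub>G\<^esub> ?h (under_arc_out D \<tau>))"
    by (rule G.finprod_multf) (use hin hout in auto)
  also have "\<dots> = (\<Otimes>\<^bsub>G\<^esub>\<tau>\<in>crossings D. ?h (under_arc_out D \<tau>))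
      \<otimes>\<^bsub>G\<^esub> (\<Otimes>\<^bsub>G\<^esub>\<tau>\<in>crossings D. inv\<^bsub>G\<^esub> ?h (under_arc_out D \<tau>))"
    by (simp only: finprod_under_arcs[OF G h])
  also have "\<dots> = (\<Otimes>\<^bsub>G\<^esub>\<tau>\<in>crossings D. ?h (under_arc_out D \<tau>) \<otimes>\<^bsub>G\<^esub> inv\<^bsub>G\<^esub> ?h (under_arc_out D \<tau>))"
    by (rule G.finprod_multf[symmetric]) (use hin hout in auto)
  also have "\<dots> = \<one>\<^bsub>G\<^esub>"
    by (rule G.finprod_one_eqI) (use hout in auto)
  finally show ?thesis .
qed

text \<open>For infinite \<open>S\<close> both sides are 0, since the sum and \<open>card\<close>
  default to 0.\<close>

lemma sum_frag_of_const: "(\<Sum>c\<in>S. frag_of a) = frag_cmul (int (card S)) (frag_of a)"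
  by (induction S rule: infinite_finite_induct) (simp_all add: frag_cmul_distrib add.commute)

theorem theorem8p4:
  fixes X :: "('a, 'm) quandle_scheme" and Y :: "('b, 'n) quandle_scheme"
    and G :: "('g, 'k) monoid_scheme" and \<pi> :: "'a \<Rightarrow> 'b"
    and L D :: curves and \<phi> :: "('b list \<Rightarrow>\<^sub>0 int) set \<Rightarrow> 'g"
  assumes "quandle X" and "quandle Y" and "finite (carrier Y)" and "comm_group G"
    and "\<pi> \<in> quandle_hom X Y" and "\<pi> ` carrier X = carrier Y" and "locally_homogeneous X \<pi>"
    and "oriented_link L" and "diagram_of D L"
    and "\<phi> \<in> quandle_cocycles Y G 2"
    and "state_sum Y G \<phi> D \<notin> group_ring_ints G"
  shows "carrier (quandle_cohomology_group X G 2) \<noteq> {\<one>\<^bsub>quandle_cohomology_group X G 2\<^esub>}"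
proof
  assume triv: "carrier (quandle_cohomology_group X G 2) = {\<one>\<^bsub>quandle_cohomology_group X G 2\<^esub>}"
  interpret X: quandle X by fact
  interpret Y: quandle Y by fact
  interpret G: comm_group G by fact
  interpret diagram D
    using \<open>diagram_of D L\<close> by (simp add: diagram_def diagram_of_def)
  let ?F = "cochain2_value Y \<phi>"
  have \<pi>: "\<pi> x \<in> carrier Y" if "x \<in> carrier X" for x
    using assms(6) that by blast
  have \<pi>_op: "\<pi> (x \<triangleright>\<^bsub>X\<^esub> y) = \<pi> x \<triangleright>\<^bsub>Y\<^esub> \<pi> y" if "x \<in> carrier X" "y \<in> carrier X" for x y
    using assms(5) that by (simp add: quandle_hom_def)
  have F: "cocycle2_fun Y G ?F"
    by (rule Y.cocycle2_fun_cochain2_value[OF G.is_group assms(10)])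
  obtain \<psi> where \<psi>: "\<psi> \<in> quandle_cocycles X G 2"
    and \<psi>F: "\<And>x y. \<lbrakk>x \<in> carrier X; y \<in> carrier X\<rbrakk> \<Longrightarrow> cochain2_value X \<psi> x y = ?F (\<pi> x) (\<pi> y)"
    using X.cocycle2_fun_realised[OF assms(4) X.cocycle2_fun_pullback[OF assms(5) F]] by blast
  obtain f where f: "f \<in> carrier X \<rightarrow> carrier G"
    and \<psi>f: "\<And>x y. \<lbrakk>x \<in> carrier X; y \<in> carrier X\<rbrakk> \<Longrightarrow>
      cochain2_value X \<psi> x y = f x \<otimes>\<^bsub>G\<^esub> inv\<^bsub>G\<^esub> f (x \<triangleright>\<^bsub>X\<^esub> y)"
    using X.coboundary2_value[OF G.is_group X.cocycle_is_coboundary[OF G.is_group \<psi> triv]] by blast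
  have "f (x \<triangleright>\<^bsub>X\<^esub> b) = f x" if xb: "x \<in> carrier X" "b \<in> carrier X" "\<pi> b = \<pi> x" for x b
  proof -
    have "f x \<otimes>\<^bsub>G\<^esub> inv\<^bsub>G\<^esub> f (x \<triangleright>\<^bsub>X\<^esub> b) = \<one>\<^bsub>G\<^esub>"
      using \<psi>F[OF xb(1,2)] \<psi>f[OF xb(1,2)] F xb(3) \<pi>[OF xb(1)] by (simp add: cocycle2_fun_def)
    moreover have "f x \<in> carrier G" "f (x \<triangleright>\<^bsub>X\<^esub> b) \<in> carrier G"
      using f xb X.q_closed by auto
    ultimately show ?thesis using G.inv_solve_right'[of "\<one>\<^bsub>G\<^esub>" "f x" "f (x \<triangleright>\<^bsub>X\<^esub> b)"] by simp
  qed
  then obtain g where g: "\<And>x. x \<in> carrier X \<Longrightarrow> f x = g (\<pi> x)"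
    using locally_homogeneous_descent[OF assms(1,2,5,6,7), of f] by blast
  \<comment> \<open>Only the composite of \<open>g\<close> with \<open>\<pi>\<close> is known;
    surjectivity of \<open>\<pi>\<close> transfers its properties to all of
    \<open>carrier Y\<close>.\<close>
  have g_closed: "g \<in> carrier Y \<rightarrow> carrier G"
  proof (rule Pi_I)
    fix u assume "u \<in> carrier Y"
    then obtain x where "x \<in> carrier X" "u = \<pi> x" using assms(6) by blast
    then show "g u \<in> carrier G" using f g by (metis PiE)
  qed
  have "?F u v = g u \<otimes>\<^bsub>G\<^esub> inv\<^bsub>G\<^esub> g (u \<triangleright>\<^bsub>Y\<^esub> v)" if uv: "u \<in> carrier Y" "v \<in> carrier Y" for u v
  proof -
    obtain x y where xy: "x \<in> carrier X" "y \<in> carrier X" "u = \<pi> x" "v = \<pi> y"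
      using uv assms(6) by (metis imageE)
    then show ?thesis using \<psi>F[of x y] \<psi>f[of x y] g \<pi>_op X.q_closed by simp
  qed
  then have "(\<Otimes>\<^bsub>G\<^esub>\<tau>\<in>crossings D. crossing_weight Y G \<phi> D C \<tau>) = \<one>\<^bsub>G\<^esub>" if "C \<in> colorings Y D" for C
    using coboundary_weight_product[OF assms(2,4) g_closed _ that] by blast
  then have "state_sum Y G \<phi> D = frag_cmul (int (card (colorings Y D))) (frag_of \<one>\<^bsub>G\<^esub>)"
    by (simp add: state_sum_def sum_frag_of_const)
  then show False using assms(11) by (simp add: group_ring_ints_def)
qed

end
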